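(* Let $r\in\mathbb{N}\cup\{\infty\}$ and let $G$ be a connected graph that is $r$-locally 2-connected. Assume that every $r$-local 2-separator of $G$ is crossed by an $r$-local 2-separator of $G$. Then $G$ is $r$-locally 3-connected or a cycle of length at most $r$.
   Context: Graphs may have loops and parallel edges. For a vertex $v$ and integer $s$, the ball $B_s(v)$ is the subgraph induced by vertices at distance at most $s$ from $v$, with all edges joining two vertices at distance exactly $s$ from $v$ removed; for a half-integer $s+\tfrac12$, $B_{s+1/2}(v)$ is the subgraph induced by vertices at distance at most $s$ from $v$. A vertex $v$ is an $r$-local cutvertex if $B_{r/2}(v)-v$ is disconnected. For vertices $v,w$, the core is the set of vertices on shortest $v$–$w$ paths. The explorer-neighbourhood $\mathrm{expl}(v,w)$ is obtained by taking a copy of $B_{r/2}(v)$ in which each vertex $u$ is labelled by the set of shortest paths from the core to $u$ contained in $B_{r/2}(v)$, a similarly labelled copy of $B_{r/2}(w)$, and taking their union where two vertices are identified only if they are copies of the same vertex of $G$ with the same label. $\{v,w\}$ is an $r$-local 2-separator if $v,w$ have distance at most $r/2$ and $\mathrm{expl}(v,w)-v-w$ is disconnected. A connected graph is $r$-locally 2-connected if it has no $r$-local cutvertex and contains a cycle of length at most $r$. A connected $r$-locally 2-connected graph is $r$-locally 3-connected if it has no $r$-local 2-separator and has at least four vertices. For an $r$-local 2-separator $\{v,w\}$, a pair $(a,b)$ of vertices of $\mathrm{expl}(v,w)$ crosses $\{v,w\}$ if $a,b$ lie in different components of $\mathrm{expl}(v,w)-v-w$ and there is a cycle of length at most $r$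 in $\mathrm{expl}(v,w)$ through $a$ and $b$ containing $v$ or $w$. A pair $(a,b)$ of distinct vertices of $G$ crosses $\{v,w\}$ if some copies of $a,b$ in $\mathrm{expl}(v,w)$ cross it. An $r$-local 2-separator $\{a_1,a_2\}$ crosses $\{b_1,b_2\}$ if $(a_1,a_2)$ crosses $\{b_1,b_2\}$.
   Formalization: The graph G is additionally assumed to be simple, or else to have at least four vertices and not be a cycle of length at most r with added loops or parallel edges; without this the claim fails, e.g. for two vertices joined by three parallel edges with r = 2. *)

theory Defs
  imports "HOL-Library.Extended_Nat"
begin

section \<open>Undirected graphs with loops and parallel edges\<close>

record ('v, 'e) mgraph =
  verts :: "'v set"
  edges :: "'e set"
  ends :: "'e \<Rightarrow> 'v set"

text \<open>Loops are the edges with a single end; distinct edges may have the same ends.  Graphs may be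
  infinite.\<close>

definition mgraph :: "('v, 'e) mgraph \<Rightarrow> bool" where
  "mgraph G \<longleftrightarrow> (\<forall>e \<in> edges G. \<exists>x \<in> verts G. \<exists>y \<in> verts G. ends G e = {x, y})"

definition simple_graph :: "('v, 'e) mgraph \<Rightarrow> bool" where
  "simple_graph G \<longleftrightarrow> (\<forall>e \<in> edges G. card (ends G e) = 2) \<and> inj_on (ends G) (edges G)"

definition at_least_four_vertices :: "('v, 'e) mgraph \<Rightarrow> bool" where
  "at_least_four_vertices G \<longleftrightarrow> infinite (verts G) \<or> 4 \<le> card (verts G)"

definition induced :: "('v, 'e) mgraph \<Rightarrow> 'v set \<Rightarrow> ('v, 'e) mgraph" where
  "induced G X = \<lparr>verts = verts G \<inter> X, edges = {e \<in> edges G. ends G e \<subseteq> X}, ends = ends G\<rparr>"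

definition del_verts :: "('v, 'e) mgraph \<Rightarrow> 'v set \<Rightarrow> ('v, 'e) mgraph" where
  "del_verts G X = induced G (verts G - X)"

text \<open>A walk is given by its vertices and its edges in order, so its length is the number of edges.\<close>

type_synonym ('v, 'e) walk = "'v list \<times> 'e list"

definition is_walk :: "('v, 'e) mgraph \<Rightarrow> ('v, 'e) walk \<Rightarrow> bool" where
  "is_walk G p \<longleftrightarrow> (case p of (xs, es) \<Rightarrow>
     length xs = Suc (length es) \<and> set xs \<subseteq> verts G \<and> set es \<subseteq> edges G \<and>
     (\<forall>i < length es. ends G (es ! i) = {xs ! i, xs ! Suc i}))"

definition wlength :: "('v, 'e) walk \<Rightarrow> nat" where
  "wlength p = length (snd p)"

definition walk_betw :: "('v, 'e) mgraph \<Rightarrow> 'v \<Rightarrow> ('v, 'e) walk \<Rightarrow> 'v \<Rightarrow> bool" where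
  "walk_betw G u p v \<longleftrightarrow> is_walk G p \<and> hd (fst p) = u \<and> last (fst p) = v"

definition is_path :: "('v, 'e) mgraph \<Rightarrow> ('v, 'e) walk \<Rightarrow> bool" where
  "is_path G p \<longleftrightarrow> is_walk G p \<and> distinct (fst p)"

text \<open>Cycles of length 1 (loops) and 2 (pairs of parallel edges) are included.\<close>

definition is_cycle :: "('v, 'e) mgraph \<Rightarrow> 'v list \<Rightarrow> 'e list \<Rightarrow> bool" where
  "is_cycle G xs es \<longleftrightarrow>
     es \<noteq> [] \<and> length xs = length es \<and> distinct xs \<and> distinct es \<and>
     set xs \<subseteq> verts G \<and> set es \<subseteq> edges G \<and>
     (\<forall>i < length es. ends G (es ! i) = {xs ! i, xs ! (Suc i mod length xs)})"

definition is_cycle_graph :: "enat \<Rightarrow> ('v, 'e) mgraph \<Rightarrow> bool" where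
  "is_cycle_graph r G \<longleftrightarrow>
     (\<exists>xs es. is_cycle G xs es \<and> verts G = set xs \<and> edges G = set es \<and> enat (length es) \<le> r)"

text \<open>A cycle of length at most \<open>r\<close> to which loops and parallel edges may have been added.  Local
  cutvertices, local 2-separators and crossing are defined by deleting vertices, so they cannot
  distinguish such a graph with at least three vertices from the cycle.\<close>

definition is_cycle_graph_up_to_multiplicity :: "enat \<Rightarrow> ('v, 'e) mgraph \<Rightarrow> bool" where
  "is_cycle_graph_up_to_multiplicity r G \<longleftrightarrow>
     (\<exists>xs es. is_cycle G xs es \<and> verts G = set xs \<and> enat (length es) \<le> r \<and>
        (\<forall>e \<in> edges G. card (ends G e) = 1 \<or> ends G e \<in> ends G ` set es))"

definition joined :: "('v, 'e) mgraph \<Rightarrow> 'v \<Rightarrow> 'v \<Rightarrow> bool" where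
  "joined G u v \<longleftrightarrow> (\<exists>p. walk_betw G u p v)"

definition connected_graph :: "('v, 'e) mgraph \<Rightarrow> bool" where
  "connected_graph G \<longleftrightarrow> verts G \<noteq> {} \<and> (\<forall>u \<in> verts G. \<forall>v \<in> verts G. joined G u v)"

text \<open>Disconnected means having at least two components.  The empty graph is neither connected nor
  disconnected.\<close>

definition disconnected_graph :: "('v, 'e) mgraph \<Rightarrow> bool" where
  "disconnected_graph G \<longleftrightarrow> (\<exists>u \<in> verts G. \<exists>v \<in> verts G. \<not> joined G u v)"

text \<open>The infimum of the empty set is \<open>\<infinity>\<close>: vertices in different components have distance \<open>\<infinity>\<close>.\<close>

definition gdist :: "('v, 'e) mgraph \<Rightarrow> 'v \<Rightarrow> 'v \<Rightarrow> enat" where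
  "gdist G u v = (INF p \<in> {p. walk_betw G u p v}. enat (wlength p))"

section \<open>Balls and local cutvertices\<close>

text \<open>The ball of integer radius \<open>s\<close>, and the ball of radius \<open>s + 1/2\<close>.\<close>

definition int_ball :: "('v, 'e) mgraph \<Rightarrow> nat \<Rightarrow> 'v \<Rightarrow> ('v, 'e) mgraph" where
  "int_ball G s v =
     (let H = induced G {u. gdist G v u \<le> enat s}
      in H\<lparr>edges := {e \<in> edges H. \<not> (\<forall>u \<in> ends H e. gdist G v u = enat s)}\<rparr>)"

definition half_ball :: "('v, 'e) mgraph \<Rightarrow> nat \<Rightarrow> 'v \<Rightarrow> ('v, 'e) mgraph" where
  "half_ball G s v = induced G {u. gdist G v u \<le> enat s}"

text \<open>The ball of radius \<open>r/2\<close>; for \<open>r = \<infinity>\<close> it is the component of the centre.\<close>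

definition local_ball :: "('v, 'e) mgraph \<Rightarrow> enat \<Rightarrow> 'v \<Rightarrow> ('v, 'e) mgraph" where
  "local_ball G r v = (case r of
       enat k \<Rightarrow> if even k then int_ball G (k div 2) v else half_ball G (k div 2) v
     | \<infinity> \<Rightarrow> induced G {u. gdist G v u < \<infinity>})"

definition local_cutvertex :: "enat \<Rightarrow> ('v, 'e) mgraph \<Rightarrow> 'v \<Rightarrow> bool" where
  "local_cutvertex r G v \<longleftrightarrow> v \<in> verts G \<and> disconnected_graph (del_verts (local_ball G r v) {v})"

definition locally_2_connected :: "enat \<Rightarrow> ('v, 'e) mgraph \<Rightarrow> bool" where
  "locally_2_connected r G \<longleftrightarrow>
     connected_graph G \<and> (\<forall>v. \<not> local_cutvertex r G v) \<and>
     (\<exists>xs es. is_cycle G xs es \<and> enat (length es) \<le> r)"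

section \<open>Explorer-neighbourhoods\<close>

definition path_from :: "('v, 'e) mgraph \<Rightarrow> 'v set \<Rightarrow> ('v, 'e) walk \<Rightarrow> 'v \<Rightarrow> bool" where
  "path_from H C p u \<longleftrightarrow> is_path H p \<and> hd (fst p) \<in> C \<and> last (fst p) = u"

definition shortest_paths :: "('v, 'e) mgraph \<Rightarrow> 'v set \<Rightarrow> 'v \<Rightarrow> ('v, 'e) walk set" where
  "shortest_paths H C u =
     {p. path_from H C p u \<and> (\<forall>q. path_from H C q u \<longrightarrow> wlength p \<le> wlength q)}"

definition core :: "('v, 'e) mgraph \<Rightarrow> 'v \<Rightarrow> 'v \<Rightarrow> 'v set" where
  "core G v w = (\<Union>p \<in> shortest_paths G {v} w. set (fst p))"

type_synonym ('v, 'e) copy = "'v \<times> ('v, 'e) walk set"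

text \<open>A copy of a vertex is the vertex with its label.  The label of \<open>u\<close> consists of the paths that are
  shortest among the paths from \<open>C\<close> to \<open>u\<close> inside the ball \<open>H\<close>, where distances may exceed those in
  the whole graph.\<close>

definition labelled :: "('v, 'e) mgraph \<Rightarrow> 'v set \<Rightarrow> 'v \<Rightarrow> ('v, 'e) copy" where
  "labelled H C u = (u, shortest_paths H C u)"

text \<open>A copy of an edge is the edge with the set of its labelled ends.  Hence, in a union of labelled
  graphs, vertices are identified iff they are copies of the same vertex with the same label, and
  edges iff they are copies of the same edge with the same ends.\<close>

definition labelled_copy ::
  "('v, 'e) mgraph \<Rightarrow> 'v set \<Rightarrow> (('v, 'e) copy, 'e \<times> ('v, 'e) copy set) mgraph" where
  "labelled_copy H C =
     \<lparr>verts = labelled H C ` verts H,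
      edges = (\<lambda>e. (e, labelled H C ` ends H e)) ` edges H,
      ends = snd\<rparr>"

definition expl ::
  "enat \<Rightarrow> ('v, 'e) mgraph \<Rightarrow> 'v \<Rightarrow> 'v \<Rightarrow> (('v, 'e) copy, 'e \<times> ('v, 'e) copy set) mgraph" where
  "expl r G v w =
     (let Hv = labelled_copy (local_ball G r v) (core G v w);
          Hw = labelled_copy (local_ball G r w) (core G v w)
      in \<lparr>verts = verts Hv \<union> verts Hw, edges = edges Hv \<union> edges Hw, ends = snd\<rparr>)"

text \<open>If \<open>v\<close> and \<open>w\<close> have distance at most \<open>r/2\<close>, then each of them has exactly one copy, whose
  label is the trivial path, since both lie in the core and in both balls.\<close>

definition copies_of :: "'v set \<Rightarrow> ('v, 'e) copy set" where
  "copies_of X = {x. fst x \<in> X}"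

definition punctured_expl ::
  "enat \<Rightarrow> ('v, 'e) mgraph \<Rightarrow> 'v \<Rightarrow> 'v \<Rightarrow> (('v, 'e) copy, 'e \<times> ('v, 'e) copy set) mgraph" where
  "punctured_expl r G v w = del_verts (expl r G v w) (copies_of {v, w})"

section \<open>Local 2-separators and crossing\<close>

definition local_2_separator :: "enat \<Rightarrow> ('v, 'e) mgraph \<Rightarrow> 'v \<Rightarrow> 'v \<Rightarrow> bool" where
  "local_2_separator r G v w \<longleftrightarrow>
     v \<in> verts G \<and> w \<in> verts G \<and> v \<noteq> w \<and> 2 * gdist G v w \<le> r \<and>
     disconnected_graph (punctured_expl r G v w)"

definition locally_3_connected :: "enat \<Rightarrow> ('v, 'e) mgraph \<Rightarrow> bool" where
  "locally_3_connected r G \<longleftrightarrow>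
     locally_2_connected r G \<and> (\<forall>v w. \<not> local_2_separator r G v w) \<and>
     at_least_four_vertices G"

definition copies_cross ::
  "enat \<Rightarrow> ('v, 'e) mgraph \<Rightarrow> ('v, 'e) copy \<Rightarrow> ('v, 'e) copy \<Rightarrow> 'v \<Rightarrow> 'v \<Rightarrow> bool" where
  "copies_cross r G a b v w \<longleftrightarrow>
     a \<in> verts (punctured_expl r G v w) \<and> b \<in> verts (punctured_expl r G v w) \<and>
     \<not> joined (punctured_expl r G v w) a b \<and>
     (\<exists>xs es. is_cycle (expl r G v w) xs es \<and> enat (length es) \<le> r \<and>
        a \<in> set xs \<and> b \<in> set xs \<and> set xs \<inter> copies_of {v, w} \<noteq> {})"

definition pair_crosses :: "enat \<Rightarrow> ('v, 'e) mgraph \<Rightarrow> 'v \<Rightarrow> 'v \<Rightarrow> 'v \<Rightarrow> 'v \<Rightarrow> bool" where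
  "pair_crosses r G a b v w \<longleftrightarrow>
     a \<in> verts G \<and> b \<in> verts G \<and> a \<noteq> b \<and>
     (\<exists>a' b'. fst a' = a \<and> fst b' = b \<and> copies_cross r G a' b' v w)"

definition separator_crosses :: "enat \<Rightarrow> ('v, 'e) mgraph \<Rightarrow> 'v \<Rightarrow> 'v \<Rightarrow> 'v \<Rightarrow> 'v \<Rightarrow> bool" where
  "separator_crosses r G a1 a2 b1 b2 \<longleftrightarrow>
     local_2_separator r G a1 a2 \<and> local_2_separator r G b1 b2 \<and> pair_crosses r G a1 a2 b1 b2"

end

theory Submission
  imports Defs
begin

text \<open>A \<open>r\<close>-local 2-separator \<open>{v, w}\<close> can be read off without the explorer-neighbourhood.  Call two darts
  (edges leaving \<open>{v, w}\<close>) linked if some walk that starts with one, ends with the other and avoids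
  \<open>{v, w}\<close> in between closes up along a geodesic to a closed walk of length at most \<open>r\<close>.  Mapping a copy
  in the explorer-neighbourhood to the last dart on a geodesic to it identifies the components of the
  punctured explorer-neighbourhood with the classes of darts under linkage.

  In this language crossing becomes symmetric: if \<open>{a, b}\<close> crosses \<open>{v, w}\<close>, then there are exactly two
  classes of darts at either pair, and every short segment from \<open>v\<close> to \<open>w\<close> meets \<open>{a, b}\<close>, since any
  other connection would link the two sides.  Consequently a short cycle split by \<open>{v, w}\<close> is itself
  split by a crossing pair \<open>{z, u}\<close> of its vertices, and then \<open>{v, z}\<close> is again a local 2-separator
  splitting the cycle, unless \<open>z\<close> is adjacent to \<open>v\<close> and the only neighbour of \<open>v\<close> on its side.
  Descending on the length of the arc from \<open>v\<close> to \<open>z\<close>, every vertex of the cycle has only its two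
  neighbours on the cycle, and by connectedness the cycle is the whole graph.\<close>

section \<open>Linkage of darts\<close>

text \<open>Everything is phrased through lengths of closed walks. An edge \<open>xy\<close> lies in
  the ball of radius r/2 around \<open>v\<close> precisely if \<open>d v x + d v y + 1\<close> is at
  most r, that is, if the edge closed up by geodesics from \<open>v\<close> is short. This one
  condition covers both parities of r and infinite r, and \<open>short\<close> is the only trace of
  r.

  The obstacle is that linkage is not transitive in one step, since two short closed walks put
  together may be too long. Classes are therefore those of a transitive closure, and every
  comparison of darts has to exhibit short closed walks. They usually arise by cutting a short
  closed walk along a geodesic.

  The absence of local cutvertices enters through \<open>dart_seg\<close>: every class of darts at a
  close pair contains a segment joining the pair. If the pair is crossing, such segments have to
  meet the crossed pair, which leaves at most two classes. That there are two comes from the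
  crossing pair being a separator itself, and this is what makes crossing symmetric.\<close>

locale short_graph =
  fixes V :: "'v set" and adj :: "'v \<Rightarrow> 'v \<Rightarrow> bool" and short :: "nat \<Rightarrow> bool"
  assumes adj_sym: "adj x y \<Longrightarrow> adj y x"
    and adj_irrefl: "\<not> adj x x"
    and adj_V: "adj x y \<Longrightarrow> x \<in> V"
    and connected: "x \<in> V \<Longrightarrow> y \<in> V \<Longrightarrow> adj\<^sup>*\<^sup>* x y"
    and short_mono: "short n \<Longrightarrow> m \<le> n \<Longrightarrow> short m"
begin

section \<open>Walks and distance\<close>

definition vwalk :: "'v \<Rightarrow> 'v list \<Rightarrow> 'v \<Rightarrow> bool" where
  "vwalk x xs y \<longleftrightarrow> successively adj xs \<and> xs \<noteq> [] \<and> hd xs = x \<and> last xs = y"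

definition d :: "'v \<Rightarrow> 'v \<Rightarrow> nat" where
  "d x y = (LEAST n. \<exists>xs. vwalk x xs y \<and> length xs = Suc n)"

lemma adj_V2: "adj x y \<Longrightarrow> y \<in> V"
  using adj_V adj_sym by blast

lemma vwalk_self: "vwalk x [x] x"
  by (simp add: vwalk_def)

lemma vwalk_append:
  assumes "vwalk x xs y" "adj y z" "vwalk z zs u"
  shows "vwalk x (xs @ zs) u"
  using assms by (auto simp: vwalk_def successively_append_iff)

lemma vwalk_snoc: "vwalk x xs y \<Longrightarrow> adj y z \<Longrightarrow> vwalk x (xs @ [z]) z"
  using vwalk_append vwalk_self by blast

lemma vwalk_Cons: "adj x y \<Longrightarrow> vwalk y ys z \<Longrightarrow> vwalk x (x # ys) z"
  using vwalk_append[OF vwalk_self] by fastforce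

lemma vwalk_join:
  assumes "vwalk x xs y" "vwalk y ys z"
  shows "vwalk x (xs @ tl ys) z"
  using assms by (cases ys) (auto simp: vwalk_def successively_append_iff successively_Cons)

lemma vwalk_rev: "vwalk x xs y \<Longrightarrow> vwalk y (rev xs) x"
  using adj_sym by (auto simp: vwalk_def hd_rev last_rev elim!: successively_mono)

lemma vwalk_split:
  assumes "vwalk x (as @ c # bs) y"
  shows "vwalk x (as @ [c]) c" "vwalk c (c # bs) y"
  using assms by (auto simp: vwalk_def successively_append_iff successively_Cons hd_append)

lemma vwalk_in_V: "vwalk x xs y \<Longrightarrow> x \<in> V \<Longrightarrow> set xs \<subseteq> V"
proof (induction xs arbitrary: x)
  case (Cons a xs)
  show ?case
  proof (cases xs)
    case Nil
    then show ?thesis using Cons by (auto simp: vwalk_def)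
  next
    case (Cons b ys)
    have "adj x b" "vwalk b xs y" using Cons.prems(1) Cons by (auto simp: vwalk_def)
    then have "set xs \<subseteq> V" using Cons.IH adj_V2 by blast
    then show ?thesis using Cons.prems by (auto simp: vwalk_def)
  qed
qed (simp add: vwalk_def)

lemma rtranclp_imp_vwalk:
  assumes "adj\<^sup>*\<^sup>* x y" shows "\<exists>xs. vwalk x xs y"
  using assms by (induction) (blast intro: vwalk_self vwalk_snoc)+

lemma d_le: "vwalk x xs y \<Longrightarrow> length xs \<le> Suc n \<Longrightarrow> d x y \<le> n"
proof -
  assume a: "vwalk x xs y" "length xs \<le> Suc n"
  obtain m where m: "length xs = Suc m" using a(1) by (cases xs) (auto simp: vwalk_def)
  have "d x y \<le> m" unfolding d_def using a m by (intro Least_le) auto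
  then show ?thesis using a m by simp
qed

lemma geodesic:
  assumes "x \<in> V" "y \<in> V"
  obtains xs where "vwalk x xs y" "length xs = Suc (d x y)"
proof -
  obtain xs where xs: "vwalk x xs y" using connected[OF assms] rtranclp_imp_vwalk by blast
  then obtain m where "length xs = Suc m" by (cases xs) (auto simp: vwalk_def)
  with xs have "\<exists>n. \<exists>xs. vwalk x xs y \<and> length xs = Suc n" by blast
  from LeastI_ex[OF this] show ?thesis using that unfolding d_def by blast
qed

lemma d_self [simp]: "d x x = 0"
  using d_le[OF vwalk_self, where n = 0 and x = x] by simp

lemma d_adj: "adj x y \<Longrightarrow> d x y \<le> 1"
  using d_le[of x "[x,y]" y 1] by (simp add: vwalk_def)

lemma d_sym:
  assumes "x \<in> V" "y \<in> V" shows "d x y = d y x"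
proof -
  have "d x y \<le> d y x" if xy: "x \<in> V" "y \<in> V" for x y
  proof -
    obtain xs where "vwalk y xs x" "length xs = Suc (d y x)" using geodesic[of y x] xy by blast
    then show ?thesis using d_le[OF vwalk_rev, of y xs x "d y x"] by simp
  qed
  then show ?thesis using assms by (simp add: antisym)
qed

lemma d_triangle:
  assumes "x \<in> V" "y \<in> V" "z \<in> V" shows "d x z \<le> d x y + d y z"
proof -
  obtain xs where xs: "vwalk x xs y" "length xs = Suc (d x y)" using geodesic assms by blast
  obtain ys where ys: "vwalk y ys z" "length ys = Suc (d y z)" using geodesic assms by blast
  show ?thesis using d_le[OF vwalk_join[OF xs(1) ys(1)]] xs ys by simp
qed

lemma d_pos: "x \<in> V \<Longrightarrow> y \<in> V \<Longrightarrow> x \<noteq> y \<Longrightarrow> 0 < d x y"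
proof (rule ccontr)
  assume a: "x \<in> V" "y \<in> V" "x \<noteq> y" "\<not> 0 < d x y"
  obtain xs where "vwalk x xs y" "length xs = Suc (d x y)" using geodesic a by blast
  with a show False by (cases xs) (auto simp: vwalk_def)
qed

text \<open>A dart is encoded as the pair \<open>(s, y)\<close> of the end in \<open>{p, q}\<close> and the other end, so parallel edges
  are the same dart.\<close>

definition link :: "'v \<Rightarrow> 'v \<Rightarrow> 'v \<times> 'v \<Rightarrow> 'v \<times> 'v \<Rightarrow> bool" where
  "link p q \<delta> \<epsilon> \<longleftrightarrow> fst \<delta> \<in> {p, q} \<and> fst \<epsilon> \<in> {p, q} \<and> adj (fst \<delta>) (snd \<delta>) \<and> adj (fst \<epsilon>) (snd \<epsilon>) \<and>
     (\<exists>xs. vwalk (snd \<delta>) xs (snd \<epsilon>) \<and> set xs \<inter> {p, q} = {} \<and>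
        short (length xs + 1 + d (fst \<delta>) (fst \<epsilon>)))"

definition eqv :: "'v \<Rightarrow> 'v \<Rightarrow> 'v \<times> 'v \<Rightarrow> 'v \<times> 'v \<Rightarrow> bool" where
  "eqv p q = (link p q)\<^sup>*\<^sup>*"

text \<open>An edge between \<open>p\<close> and \<open>q\<close> is excluded: it is linked to
  nothing and would form a class of its own.\<close>

definition dart :: "'v \<Rightarrow> 'v \<Rightarrow> 'v \<times> 'v \<Rightarrow> bool" where
  "dart p q \<delta> \<longleftrightarrow> fst \<delta> \<in> {p, q} \<and> adj (fst \<delta>) (snd \<delta>) \<and> snd \<delta> \<notin> {p, q}"

definition sep :: "'v \<Rightarrow> 'v \<Rightarrow> bool" where
  "sep p q \<longleftrightarrow> p \<in> V \<and> q \<in> V \<and> p \<noteq> q \<and> short (2 * d p q) \<and>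
     (\<exists>\<delta> \<epsilon>. dart p q \<delta> \<and> dart p q \<epsilon> \<and> \<not> eqv p q \<delta> \<epsilon>)"

text \<open>A dart that reaches \<open>x\<close> from the anchor \<open>o1\<close> lies on a short closed walk through \<open>o1\<close> and \<open>x\<close>; the
  anchor singles out one lift of \<open>x\<close> in the universal cover that unfolds all longer cycles.\<close>

definition reach :: "'v \<Rightarrow> 'v \<Rightarrow> 'v \<Rightarrow> 'v \<times> 'v \<Rightarrow> 'v \<Rightarrow> bool" where
  "reach p q o1 \<delta> x \<longleftrightarrow> fst \<delta> \<in> {p, q} \<and> adj (fst \<delta>) (snd \<delta>) \<and>
     (\<exists>xs. vwalk (snd \<delta>) xs x \<and> set xs \<inter> {p, q} = {} \<and> short (length xs + d o1 (fst \<delta>) + d o1 x))"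

lemma linkI:
  assumes "vwalk y xs z" "set xs \<inter> {p, q} = {}" "adj s y" "adj z t" "s \<in> {p, q}" "t \<in> {p, q}"
    "short (length xs + 1 + d s t)"
  shows "link p q (s, y) (t, z)"
  using assms adj_sym[of z t] unfolding link_def by auto

lemma link_fst_V: "link p q \<delta> \<epsilon> \<Longrightarrow> fst \<delta> \<in> V \<and> fst \<epsilon> \<in> V"
  using adj_V by (auto simp: link_def)

lemma link_sym: "link p q \<delta> \<epsilon> \<Longrightarrow> link p q \<epsilon> \<delta>"
proof -
  assume l: "link p q \<delta> \<epsilon>"
  then obtain xs where "vwalk (snd \<delta>) xs (snd \<epsilon>)" "set xs \<inter> {p, q} = {}"
    "short (length xs + 1 + d (fst \<delta>) (fst \<epsilon>))" by (auto simp: link_def)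
  then have "vwalk (snd \<epsilon>) (rev xs) (snd \<delta>)" "set (rev xs) \<inter> {p, q} = {}"
    "short (length (rev xs) + 1 + d (fst \<epsilon>) (fst \<delta>))"
    using vwalk_rev d_sym link_fst_V[OF l] by auto
  with l show ?thesis unfolding link_def by blast
qed

lemma eqv_refl: "eqv p q \<delta> \<delta>"
  by (simp add: eqv_def)

lemma eqv_trans: "eqv p q \<delta> \<epsilon> \<Longrightarrow> eqv p q \<epsilon> \<phi> \<Longrightarrow> eqv p q \<delta> \<phi>"
  by (simp add: eqv_def)

lemma link_eqv: "link p q \<delta> \<epsilon> \<Longrightarrow> eqv p q \<delta> \<epsilon>"
  by (simp add: eqv_def)

lemma eqv_sym: "eqv p q \<delta> \<epsilon> \<Longrightarrow> eqv p q \<epsilon> \<delta>"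
  unfolding eqv_def
  by (metis sympD sympI symp_rtranclp link_sym)

lemma link_swap: "link p q = link q p"
  by (simp add: link_def fun_eq_iff insert_commute)

lemma eqv_swap: "eqv p q = eqv q p"
  by (simp add: eqv_def link_swap)

lemma dart_swap: "dart p q = dart q p"
  by (auto simp: dart_def fun_eq_iff)

lemma sep_swap: "sep p q \<Longrightarrow> sep q p"
  using d_sym by (auto simp: sep_def eqv_swap[of q] dart_swap[of q])

lemma reachI:
  assumes "vwalk y xs x" "set xs \<inter> {p, q} = {}" "adj s y" "s \<in> {p, q}"
    "short (length xs + d o1 s + d o1 x)"
  shows "reach p q o1 (s, y) x"
  using assms unfolding reach_def by auto

lemma reach_V: "reach p q o1 \<delta> x \<Longrightarrow> x \<in> V"
  unfolding reach_def using adj_V2 vwalk_in_V by (metis in_mono last_in_set vwalk_def)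

lemma reach_notin: "reach p q o1 \<delta> x \<Longrightarrow> x \<notin> {p, q}"
  unfolding reach_def vwalk_def by (metis disjoint_iff last_in_set)

text \<open>Cut a geodesic from \<open>o1\<close> to \<open>x\<close> at its last visit of
  \<open>{p, q}\<close>. Both pieces are geodesics again, hence the equation of lengths.\<close>

lemma canonical_dart:
  assumes "p \<in> V" "q \<in> V" "o1 \<in> {p, q}" "x \<in> V" "x \<notin> {p, q}"
  obtains s y xs where "s \<in> {p, q}" "adj s y" "vwalk y xs x" "set xs \<inter> {p, q} = {}"
    "length xs + d o1 s = d o1 x"
proof -
  have oV: "o1 \<in> V" using assms by auto
  obtain g where g: "vwalk o1 g x" "length g = Suc (d o1 x)" using geodesic[OF oV assms(4)] by blast
  have "\<exists>s \<in> set g. s \<in> {p, q}" using g(1) assms(3) by (metis list.set_sel(1) vwalk_def)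
  then obtain as s bs where sp: "g = as @ s # bs" "s \<in> {p, q}" "\<forall>b \<in> set bs. b \<notin> {p, q}"
    using split_list_last_prop[of g "\<lambda>s. s \<in> {p, q}"] by blast
  have bs: "bs \<noteq> []" using g(1) sp assms(5) by (auto simp: vwalk_def)
  have w1: "vwalk o1 (as @ [s]) s" and w2: "vwalk s (s # bs) x" using vwalk_split g(1) sp(1) by auto
  have a: "adj s (hd bs)" and w3: "vwalk (hd bs) bs x" using w2 bs by (auto simp: vwalk_def successively_Cons)
  have sV: "s \<in> V" using sp assms by auto
  have "d o1 s \<le> length as" using d_le[OF w1] by simp
  moreover have "d s x \<le> length bs" using d_le[OF w2] by simp
  moreover have "d o1 x \<le> d o1 s + d s x" using d_triangle oV sV assms(4) by blast
  ultimately have "length bs + d o1 s = d o1 x" using g(2) sp(1) by simp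
  then show ?thesis using that[OF sp(2) a w3] sp(3) by auto
qed

text \<open>Return from \<open>x\<close> along the canonical walk. The triangle inequality through
  \<open>o1\<close> bounds the distance between the two ends in \<open>{p, q}\<close>, so the closed
  walk is no longer than the one in \<open>reach\<close>.\<close>

lemma reach_canonical:
  assumes "p \<in> V" "q \<in> V" "o1 \<in> {p, q}" "reach p q o1 \<delta> x"
    and c: "s \<in> {p, q}" "adj s y" "vwalk y ys x" "set ys \<inter> {p, q} = {}" "length ys + d o1 s = d o1 x"
  shows "link p q \<delta> (s, y)"
proof -
  obtain xs where xs: "vwalk (snd \<delta>) xs x" "set xs \<inter> {p, q} = {}"
      "short (length xs + d o1 (fst \<delta>) + d o1 x)" "fst \<delta> \<in> {p, q}" "adj (fst \<delta>) (snd \<delta>)"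
    using assms(4) by (auto simp: reach_def)
  have ys: "ys \<noteq> []" "last ys = x" using c by (auto simp: vwalk_def)
  have w: "vwalk (snd \<delta>) (xs @ tl (rev ys)) y" using vwalk_join[OF xs(1) vwalk_rev[OF c(3)]] .
  have V: "o1 \<in> V" "fst \<delta> \<in> V" "s \<in> V" using assms xs(4) by auto
  have "d (fst \<delta>) s \<le> d o1 (fst \<delta>) + d o1 s" using d_triangle[of "fst \<delta>" o1 s] d_sym V by simp
  then have "length (xs @ tl (rev ys)) + 1 + d (fst \<delta>) s \<le> length xs + d o1 (fst \<delta>) + d o1 x"
    using c(5) ys(1) by (cases ys) auto
  then have sh: "short (length (xs @ tl (rev ys)) + 1 + d (fst \<delta>) s)" using short_mono xs(3) by blast
  have "set (tl (rev ys)) \<subseteq> set ys" by (metis list.set_sel(2) set_rev subsetI tl_Nil)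
  then have "set (xs @ tl (rev ys)) \<inter> {p, q} = {}" using xs(2) c(4) by auto
  from linkI[OF w this xs(5) adj_sym[OF c(2)] xs(4) c(1) sh] show ?thesis by simp
qed

text \<open>The canonical dart mediates. Hence, for a fixed anchor, a vertex determines a single
  class.\<close>

lemma reach_eqv:
  assumes "p \<in> V" "q \<in> V" "o1 \<in> {p, q}" "reach p q o1 \<delta> x" "reach p q o1 \<epsilon> x"
  shows "eqv p q \<delta> \<epsilon>"
proof -
  obtain s y ys where c: "s \<in> {p, q}" "adj s y" "vwalk y ys x" "set ys \<inter> {p, q} = {}" "length ys + d o1 s = d o1 x"
    using canonical_dart[OF assms(1-3) reach_V[OF assms(4)] reach_notin[OF assms(4)]] by metis
  have "link p q \<delta> (s, y)" "link p q \<epsilon> (s, y)" using reach_canonical assms c by blast+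
  then show ?thesis using link_eqv link_sym eqv_trans by blast
qed

text \<open>The bound says that the edge lies in the ball around the anchor, so classes are constant
  along edges of the ball.\<close>

lemma reach_step:
  assumes "p \<in> V" "q \<in> V" "o1 \<in> {p, q}" "reach p q o1 \<delta> x" "adj x x'" "x' \<notin> {p, q}"
    "short (d o1 x + d o1 x' + 1)"
  obtains \<epsilon> where "eqv p q \<delta> \<epsilon>" "reach p q o1 \<epsilon> x'"
proof -
  obtain s y ys where c: "s \<in> {p, q}" "adj s y" "vwalk y ys x" "set ys \<inter> {p, q} = {}" "length ys + d o1 s = d o1 x"
    using canonical_dart[OF assms(1-3) reach_V[OF assms(4)] reach_notin[OF assms(4)]] by metis
  have "link p q \<delta> (s, y)" using reach_canonical assms c by blast
  moreover have "reach p q o1 (s, y) x'"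
  proof (rule reachI)
    show "vwalk y (ys @ [x']) x'" using c(3) assms(5) vwalk_snoc by blast
    show "short (length (ys @ [x']) + d o1 s + d o1 x')"
      using assms(7) c(5) by (simp add: add.commute add.left_commute)
  qed (use c assms in auto)
  ultimately show ?thesis using that link_eqv by blast
qed

text \<open>Only the interior is recorded, so \<open>length S + 1\<close> counts edges, and
  \<open>S \<noteq> []\<close> excludes the edge \<open>pq\<close>. A segment is a link from a dart
  at \<open>p\<close> to a dart at \<open>q\<close>.\<close>

definition seg :: "'v \<Rightarrow> 'v \<Rightarrow> 'v list \<Rightarrow> bool" where
  "seg p q S \<longleftrightarrow> S \<noteq> [] \<and> vwalk p (p # S @ [q]) q \<and> set S \<inter> {p, q} = {} \<and>
     short (length S + 1 + d p q)"

lemma segD: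
  assumes "seg p q S"
  shows "S \<noteq> []" "vwalk (hd S) S (last S)" "adj p (hd S)" "adj (last S) q" "set S \<inter> {p, q} = {}"
    "short (length S + 1 + d p q)" "p \<in> V" "q \<in> V"
proof -
  show a: "S \<noteq> []" "set S \<inter> {p, q} = {}" "short (length S + 1 + d p q)"
    using assms by (auto simp: seg_def)
  show "vwalk (hd S) S (last S)" "adj p (hd S)" "adj (last S) q"
    using assms a by (auto simp: seg_def vwalk_def successively_Cons successively_append_iff)
  then show "p \<in> V" "q \<in> V" using adj_V adj_V2 by auto
qed

lemma segI:
  assumes "vwalk y S z" "adj p y" "adj z q" "set S \<inter> {p, q} = {}" "short (length S + 1 + d p q)"
  shows "seg p q S"
  using assms by (auto simp: seg_def vwalk_def successively_Cons successively_append_iff)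

lemma seg_link: "seg p q S \<Longrightarrow> link p q (p, hd S) (q, last S)"
  using segD linkI by (metis insertI1 insertI2 singletonI)

lemma seg_rev: "seg p q S \<Longrightarrow> seg q p (rev S)"
proof -
  assume s: "seg p q S"
  have "short (length (rev S) + 1 + d q p)" using segD[OF s] d_sym by simp
  then show ?thesis
    using segI[OF vwalk_rev[OF segD(2)[OF s]] adj_sym[OF segD(4)[OF s]] adj_sym[OF segD(3)[OF s]]] segD[OF s]
    by auto
qed

text \<open>Cut both segments at \<open>x\<close>: the two halves at \<open>p\<close> or the two halves at \<open>q\<close> form a short closed walk.\<close>

lemma seg_share:
  assumes S: "seg p q S" and T: "seg p q T" and x: "x \<in> set S" "x \<in> set T"
  shows "eqv p q (p, hd S) (p, hd T)"
proof -
  note SD = segD[OF S] and TD = segD[OF T]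
  obtain S1 S2 where s: "S = S1 @ x # S2" using x by (meson split_list)
  obtain T1 T2 where t: "T = T1 @ x # T2" using x by (meson split_list)
  have ws: "vwalk (hd S) (S1 @ [x]) x" "vwalk x (x # S2) (last S)" using vwalk_split SD(2) s by metis+
  have wt: "vwalk (hd T) (T1 @ [x]) x" "vwalk x (x # T2) (last T)" using vwalk_split TD(2) t by metis+
  \<comment> \<open>The two left-hand sides add up to \<open>length S + length T + 2\<close>, which
    is at most twice the maximum.\<close>
  have "length S1 + length T1 + 2 \<le> max (length S + 1 + d p q) (length T + 1 + d p q) \<or>
        length S2 + length T2 + 2 \<le> max (length S + 1 + d p q) (length T + 1 + d p q)"
    using s t by auto
  then consider "short (length S1 + length T1 + 2)" | "short (length S2 + length T2 + 2)"
    using SD(6) TD(6) short_mono by (metis max_def)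
  then show ?thesis
  proof cases
    case 1
    have "vwalk (hd S) ((S1 @ [x]) @ tl (rev (T1 @ [x]))) (hd T)"
      using vwalk_join[OF ws(1) vwalk_rev[OF wt(1)]] .
    then have "link p q (p, hd S) (p, hd T)"
    proof (rule linkI)
      show "short (length ((S1 @ [x]) @ tl (rev (T1 @ [x]))) + 1 + d p p)"
        using 1 by (simp add: add.commute)
    qed (use SD(3,5) adj_sym[OF TD(3)] TD(5) s t in auto)
    then show ?thesis by (rule link_eqv)
  next
    case 2
    have "vwalk (last S) (rev (x # S2) @ tl (x # T2)) (last T)"
      using vwalk_join[OF vwalk_rev[OF ws(2)] wt(2)] .
    then have "link p q (q, last S) (q, last T)"
    proof (rule linkI)
      show "short (length (rev (x # S2) @ tl (x # T2)) + 1 + d q q)"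
        using 2 by (simp add: add.commute)
    qed (use adj_sym[OF SD(4)] SD(5) TD(4,5) s t in auto)
    then show ?thesis using seg_link[OF S] seg_link[OF T] by (meson link_eqv eqv_sym eqv_trans)
  qed
qed

text \<open>The two walks need not be paths: they arise by projecting a cycle of the
  explorer-neighbourhood, on which several copies of a vertex may occur. Only \<open>a\<close> and
  \<open>b\<close> are visited once, so that they can take over the role of \<open>v\<close> and
  \<open>w\<close> when the crossing is flipped. The constant 4 counts \<open>v\<close>,
  \<open>w\<close>, \<open>a\<close> and \<open>b\<close>.\<close>

definition crossing ::
  "'v \<Rightarrow> 'v \<Rightarrow> 'v \<Rightarrow> 'v \<Rightarrow> 'v list \<Rightarrow> 'v list \<Rightarrow> 'v list \<Rightarrow> 'v list \<Rightarrow> bool" where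
  "crossing v w a b A1 A2 B1 B2 \<longleftrightarrow> v \<noteq> w \<and>
     vwalk v (v # A1 @ a # A2 @ [w]) w \<and> vwalk v (v # B1 @ b # B2 @ [w]) w \<and>
     v \<notin> set (A1 @ a # A2 @ B1 @ b # B2) \<and> w \<notin> set (A1 @ a # A2 @ B1 @ b # B2) \<and>
     a \<notin> set A1 \<union> set A2 \<and> b \<notin> set B1 \<union> set B2 \<and>
     short (length A1 + length A2 + length B1 + length B2 + 4) \<and>
     \<not> eqv v w (v, hd (A1 @ [a])) (v, hd (B1 @ [b]))"

lemma crossing_swap: "crossing v w a b A1 A2 B1 B2 \<Longrightarrow> crossing v w b a B1 B2 A1 A2"
  using eqv_sym unfolding crossing_def by (auto simp: add.commute add.left_commute)

lemma crossing_V: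
  assumes "crossing v w a b A1 A2 B1 B2"
  shows "v \<in> V" "w \<in> V" "a \<in> V" "b \<in> V"
proof -
  have c: "vwalk v (v # A1 @ a # A2 @ [w]) w" "vwalk v (v # B1 @ b # B2 @ [w]) w"
    using assms by (auto simp: crossing_def)
  show v: "v \<in> V" using c(1) adj_V by (auto simp: vwalk_def successively_Cons)
  show "w \<in> V" "a \<in> V" "b \<in> V" using vwalk_in_V[OF c(1) v] vwalk_in_V[OF c(2) v] by auto
qed

text \<open>Each walk closes up with a geodesic, which is no longer than the other walk.\<close>

lemma crossing_seg:
  assumes "crossing v w a b A1 A2 B1 B2"
  shows "seg v w (A1 @ a # A2)" "seg v w (B1 @ b # B2)"
    "d v w \<le> length A1 + length A2 + 2" "d v w \<le> length B1 + length B2 + 2"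
proof -
  note c = assms[unfolded crossing_def]
  show 1: "d v w \<le> length A1 + length A2 + 2"
    using d_le[of v "v # A1 @ a # A2 @ [w]" w] c by simp
  show 2: "d v w \<le> length B1 + length B2 + 2"
    using d_le[of v "v # B1 @ b # B2 @ [w]" w] c by simp
  show "seg v w (A1 @ a # A2)" "seg v w (B1 @ b # B2)"
    unfolding seg_def using c 1 2 by (auto intro: short_mono)
qed

lemma hd_append_Cons: "hd (xs @ y # ys) = hd (xs @ [y])"
  by (cases xs) auto

lemma crossing_disjoint:
  assumes "crossing v w a b A1 A2 B1 B2"
  shows "set (A1 @ a # A2) \<inter> set (B1 @ b # B2) = {}"
proof (rule equals0I)
  fix x assume x: "x \<in> set (A1 @ a # A2) \<inter> set (B1 @ b # B2)"
  from seg_share[OF crossing_seg(1,2)[OF assms] IntD1[OF x] IntD2[OF x]] show False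
    using assms by (simp add: crossing_def hd_append_Cons[of A1 a A2] hd_append_Cons[of B1 b B2])
qed

end

section \<open>Crossing pairs\<close>

context short_graph begin

lemma link_seg:
  assumes "link p q (p, y) (q, z)"
  obtains S where "seg p q S" "hd S = y" "last S = z"
proof -
  obtain xs where xs: "vwalk y xs z" "set xs \<inter> {p, q} = {}" "short (length xs + 1 + d p q)" "adj p y" "adj q z"
    using assms by (auto simp: link_def)
  have "seg p q xs" using segI[OF xs(1) xs(4) adj_sym[OF xs(5)] xs(2,3)] .
  then show ?thesis using that xs(1) by (auto simp: vwalk_def)
qed

text \<open>A walk from \<open>a\<close> to \<open>b\<close> avoiding \<open>v\<close> and \<open>w\<close>, closed up by a geodesic, would link the two sides
  of the crossed pair.\<close>

lemma crossing_no_bypass: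
  assumes c: "crossing v w a b A1 A2 B1 B2" and T: "vwalk a T b" "set T \<inter> {v, w} = {}"
  shows "\<not> short (length T - 1 + d a b)"
proof
  assume sh: "short (length T - 1 + d a b)"
  note cD = c[unfolded crossing_def] and V = crossing_V[OF c]
  let ?A = "(v, hd (A1 @ [a]))" and ?B = "(v, hd (B1 @ [b]))"
  have cA: "vwalk v (v # A1 @ a # A2 @ [w]) w" and cB: "vwalk v (v # B1 @ b # B2 @ [w]) w" using cD by auto
  have wA: "vwalk v ((v # A1) @ [a]) a" "vwalk a (a # A2 @ [w]) w"
    using vwalk_split[of v "v # A1" a "A2 @ [w]" w] cA by auto
  have wB: "vwalk v ((v # B1) @ [b]) b" "vwalk b (b # B2 @ [w]) w"
    using vwalk_split[of v "v # B1" b "B2 @ [w]" w] cB by auto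
  have hA: "vwalk (hd (A1 @ [a])) (A1 @ [a]) a" "adj v (hd (A1 @ [a]))"
    using wA(1) by (auto simp: vwalk_def successively_Cons)
  have hB: "vwalk (hd (B1 @ [b])) (B1 @ [b]) b" "adj v (hd (B1 @ [b]))"
    using wB(1) by (auto simp: vwalk_def successively_Cons)
  have dva: "d v a \<le> length A1 + 1" using d_le[OF wA(1)] by simp
  have dvb: "d v b \<le> length B1 + 1" using d_le[OF wB(1)] by simp
  have dwa: "d w a \<le> length A2 + 1" using d_le[OF wA(2)] d_sym V by simp
  have dwb: "d w b \<le> length B2 + 1" using d_le[OF wB(2)] d_sym V by simp
  have dvw: "d v w \<le> length A1 + length A2 + 2" "d v w \<le> length B1 + length B2 + 2"
    using crossing_seg[OF c] by auto
  have dab: "d a b \<le> length A1 + length B1 + 2" "d a b \<le> length A2 + length B2 + 2"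
    using d_triangle[OF V(3) V(1) V(4)] d_triangle[OF V(3) V(2) V(4)] dva dvb dwa dwb
      d_sym[OF V(3) V(1)] d_sym[OF V(3) V(2)] by auto
  have tot: "short (length A1 + length A2 + length B1 + length B2 + 4)" using cD by simp
  have nAB: "\<not> eqv v w ?A ?B" using cD by simp
  obtain J where J: "vwalk a J b" "length J = Suc (d a b)" using geodesic V by blast
  \<comment> \<open>A geodesic avoiding both vertices would connect the initial parts
    \<open>A1\<close> and \<open>B1\<close> directly. The closed walk is short because
    \<open>d a b\<close> is at most the length of the way from \<open>a\<close> to \<open>b\<close>
    through \<open>w\<close>.\<close>
  have "\<exists>s \<in> set J. s \<in> {v, w}"
  proof (rule ccontr)
    assume "\<not> ?thesis"
    then have Ji: "set J \<inter> {v, w} = {}" by blast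
    have w1: "vwalk (hd (A1 @ [a])) ((A1 @ [a]) @ tl J) b" using vwalk_join[OF hA(1) J(1)] .
    have w2: "vwalk (hd (A1 @ [a])) (((A1 @ [a]) @ tl J) @ tl (rev (B1 @ [b]))) (hd (B1 @ [b]))"
      using vwalk_join[OF w1 vwalk_rev[OF hB(1)]] .
    have "link v w ?A ?B"
    proof (rule linkI[OF w2 _ hA(2) adj_sym[OF hB(2)]])
      have "set (tl J) \<subseteq> set J" by (metis list.set_sel(2) subsetI tl_Nil)
      then show "set (((A1 @ [a]) @ tl J) @ tl (rev (B1 @ [b]))) \<inter> {v, w} = {}" using Ji cD by auto
      show "short (length (((A1 @ [a]) @ tl J) @ tl (rev (B1 @ [b]))) + 1 + d v v)"
        using short_mono[OF tot] J(2) dab by simp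
    qed auto
    then show False using nAB link_eqv by blast
  qed
  \<comment> \<open>\<open>s\<close> and \<open>t\<close> are the first and the last visit of the
    geodesic to \<open>{v, w}\<close>; they may coincide.\<close>
  then obtain J1 s R where JR: "J = J1 @ s # R" "s \<in> {v, w}" "\<forall>x \<in> set J1. x \<notin> {v, w}"
    using split_list_first_prop[of J "\<lambda>s. s \<in> {v, w}"] by blast
  obtain M t J2 where M: "s # R = M @ t # J2" "t \<in> {v, w}" "\<forall>x \<in> set J2. x \<notin> {v, w}"
    using split_list_last_prop[of "s # R" "\<lambda>s. s \<in> {v, w}"] JR(2) by force
  have wJ: "vwalk a (J1 @ [s]) s" "vwalk s (s # R) b" using vwalk_split J(1) JR(1) by auto
  have wM: "vwalk s (M @ [t]) t" "vwalk t (t # J2) b" using vwalk_split wJ(2) M(1) by auto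
  have an: "a \<notin> {v, w}" "b \<notin> {v, w}" using cD by auto
  have J1: "J1 \<noteq> []" using wJ(1) JR(2) an by (auto simp: vwalk_def)
  have J2: "J2 \<noteq> []" using wM(2) M(2) an by (auto simp: vwalk_def)
  have w1: "vwalk a J1 (last J1)" "adj (last J1) s"
    using wJ(1) J1 by (auto simp: vwalk_def successively_append_iff)
  have w2: "vwalk (hd J2) J2 b" "adj t (hd J2)"
    using wM(2) J2 by (auto simp: vwalk_def successively_Cons)
  have len: "length J1 + length M + length J2 = d a b"
    using J(2) JR(1) arg_cong[OF M(1), of length] by simp
  have dst: "d s t \<le> length M" using d_le[OF wM(1)] by simp
  have T0: "T \<noteq> []" using T(1) by (simp add: vwalk_def)
  have w3: "vwalk (last J1) ((rev J1 @ tl T) @ tl (rev J2)) (hd J2)"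
    using vwalk_join[OF vwalk_join[OF vwalk_rev[OF w1(1)] T(1)] vwalk_rev[OF w2(1)]] .
  \<comment> \<open>In the closed walk formed by \<open>T\<close> and \<open>J\<close>, the part of
    \<open>J\<close> between \<open>s\<close> and \<open>t\<close> bounds \<open>d s t\<close>, and
    the rest avoids \<open>{v, w}\<close>.\<close>
  have l1: "link v w (s, last J1) (t, hd J2)"
  proof (rule linkI[OF w3 _ adj_sym[OF w1(2)] adj_sym[OF w2(2)]])
    have "set (tl T) \<subseteq> set T" "set (tl (rev J2)) \<subseteq> set J2"
      by (metis list.set_sel(2) subsetI tl_Nil set_rev)+
    then show "set ((rev J1 @ tl T) @ tl (rev J2)) \<inter> {v, w} = {}" using T(2) JR(3) M(3) by auto
    show "short (length ((rev J1 @ tl T) @ tl (rev J2)) + 1 + d s t)"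
      by (rule short_mono[OF sh]) (use len dst J1 J2 T0 in \<open>cases J2; cases T; auto\<close>)
  qed (use JR M in auto)
  have sV: "s \<in> V" "t \<in> V" using V JR(2) M(2) by auto
  \<comment> \<open>It remains to see that the ends of the link lie on the sides of \<open>a\<close>
    and \<open>b\<close>. Comparisons at \<open>a\<close> are anchored at \<open>s\<close> and those
    at \<open>b\<close> at \<open>t\<close>, so that the pieces of the geodesic are
    canonical.\<close>
  have r1: "reach v w s (s, last J1) a"
  proof (rule reachI[OF vwalk_rev[OF w1(1)] _ adj_sym[OF w1(2)]])
    have "d s a \<le> length J1" using d_le[OF wJ(1)] d_sym[OF sV(1) V(3)] by simp
    then show "short (length (rev J1) + d s s + d s a)"
      using short_mono[OF tot] len dab by simp
  qed (use JR in auto)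
  have r2: "reach v w s ?A a"
  proof (rule reachI[OF hA(1) _ hA(2)])
    show "short (length (A1 @ [a]) + d s v + d s a)"
      using short_mono[OF tot] JR(2) dwa dva dvw d_sym[OF V(1,2)]
        d_triangle[OF V(1,2,3)] d_triangle[OF V(2,1,3)] by auto
  qed (use cD in auto)
  have r3: "reach v w t (t, hd J2) b"
  proof (rule reachI[OF w2(1) _ w2(2)])
    have "d t b \<le> length J2" using d_le[OF wM(2)] by simp
    then show "short (length J2 + d t t + d t b)"
      using short_mono[OF tot] len dab by simp
  qed (use M in auto)
  have r4: "reach v w t ?B b"
  proof (rule reachI[OF hB(1) _ hB(2)])
    show "short (length (B1 @ [b]) + d t v + d t b)"
      using short_mono[OF tot] M(2) dwb dvb dvw d_sym[OF V(1,2)]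
        d_triangle[OF V(1,2,4)] d_triangle[OF V(2,1,4)] by auto
  qed (use cD in auto)
  have "eqv v w ?A (s, last J1)" "eqv v w (t, hd J2) ?B"
    using reach_eqv[OF V(1,2)] r1 r2 r3 r4 JR(2) M(2) by blast+
  then show False using l1 nAB link_eqv eqv_trans by blast
qed

lemma crossing_flip_walks:
  assumes c: "crossing v w a b A1 A2 B1 B2"
  shows "vwalk a (a # rev A1 @ v # B1 @ [b]) b" "vwalk a (a # A2 @ w # rev B2 @ [b]) b"
proof -
  have cA: "vwalk v (v # A1 @ a # A2 @ [w]) w" and cB: "vwalk v (v # B1 @ b # B2 @ [w]) w"
    using c[unfolded crossing_def] by auto
  have wA: "vwalk v ((v # A1) @ [a]) a" "vwalk a (a # A2 @ [w]) w"
    using vwalk_split[of v "v # A1" a "A2 @ [w]" w] cA by auto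
  have wB: "vwalk v ((v # B1) @ [b]) b" "vwalk b (b # B2 @ [w]) w"
    using vwalk_split[of v "v # B1" b "B2 @ [w]" w] cB by auto
  show "vwalk a (a # rev A1 @ v # B1 @ [b]) b" using vwalk_join[OF vwalk_rev[OF wA(1)] wB(1)] by simp
  show "vwalk a (a # A2 @ w # rev B2 @ [b]) b" using vwalk_join[OF wA(2) vwalk_rev[OF wB(2)]] by simp
qed

lemma crossing_flip_seg:
  assumes c: "crossing v w a b A1 A2 B1 B2"
  shows "seg a b (rev A1 @ v # B1)" "seg a b (A2 @ w # rev B2)"
proof -
  note cD = c[unfolded crossing_def]
  have dis: "a \<notin> set (B1 @ b # B2)" "b \<notin> set (A1 @ a # A2)" using crossing_disjoint[OF c] by auto
  have 1: "d a b \<le> length A1 + length B1 + 2" using d_le[OF crossing_flip_walks(1)[OF c]] by simp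
  have 2: "d a b \<le> length A2 + length B2 + 2" using d_le[OF crossing_flip_walks(2)[OF c]] by simp
  show "seg a b (rev A1 @ v # B1)" "seg a b (A2 @ w # rev B2)"
    unfolding seg_def using crossing_flip_walks[OF c] cD dis 1 2 by (auto elim!: short_mono)
qed

lemma crossing_not_adj:
  assumes c: "crossing v w a b A1 A2 B1 B2"
  shows "\<not> adj a b"
proof
  assume ab: "adj a b"
  have "short (length [a, b] - 1 + d a b)"
    using c d_adj[OF ab] by (auto simp: crossing_def elim!: short_mono)
  then show False
    using crossing_no_bypass[OF c, of "[a, b]"] ab c by (auto simp: vwalk_def crossing_def)
qed

end

text \<open>The relation is adjacency in the ball of radius r/2 around \<open>v\<close> with
  \<open>v\<close> removed, so the assumption says that \<open>v\<close> is not a local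
  cutvertex.\<close>

locale short_graph_2con = short_graph V adj short
  for V :: "'v set" and adj short +
  assumes ball_connected:
    "\<lbrakk>v \<in> V; x \<in> V; y \<in> V; x \<noteq> v; y \<noteq> v; short (2 * d v x); short (2 * d v y)\<rbrakk> \<Longrightarrow>
     (\<lambda>a b. adj a b \<and> a \<noteq> v \<and> b \<noteq> v \<and> short (d v a + d v b + 1))\<^sup>*\<^sup>* x y"
begin

text \<open>Follow a walk from \<open>y\<close> to \<open>q\<close> in the ball around
  \<open>p\<close> minus \<open>p\<close>. As long as no segment of the class has appeared, the
  canonical dart to the current vertex starts at \<open>p\<close>: one starting at \<open>q\<close>
  would be linked to a dart of the class at \<open>p\<close>, and that link is a segment. On arrival
  at \<open>q\<close> the canonical walk itself is a segment.\<close>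

lemma dart_seg_left:
  assumes V: "p \<in> V" "q \<in> V" "p \<noteq> q" and sh: "short (2 * d p q)" and y: "adj p y" "y \<notin> {p, q}"
  obtains S where "seg p q S" "eqv p q (p, y) (p, hd S)"
proof -
  let ?R = "\<lambda>a b. adj a b \<and> a \<noteq> p \<and> b \<noteq> p \<and> short (d p a + d p b + 1)"
  let ?P = "\<lambda>x. (\<exists>S. seg p q S \<and> eqv p q (p, y) (p, hd S)) \<or>
                (x \<noteq> q \<and> (\<exists>z. eqv p q (p, y) (p, z) \<and> reach p q p (p, z) x))"
  have s2: "short 2" using short_mono[OF sh] d_pos[OF V] by simp
  have yV: "y \<in> V" using y adj_V2 by blast
  have d1: "d p y \<le> 1" using d_adj y by blast
  have chain: "?R\<^sup>*\<^sup>* y q"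
    using ball_connected[of p y q] V y yV sh short_mono[OF s2] d1 by auto
  have "?P x" if "?R\<^sup>*\<^sup>* y x" for x
    using that
  proof (induction)
    case base
    have "reach p q p (p, y) y"
      using reachI[OF vwalk_self, of y p q p p] y short_mono[OF s2] d1 by auto
    moreover have "y \<noteq> q" using y by simp
    ultimately show ?case using eqv_refl by blast
  next
    case (step x x')
    show ?case
    proof (cases "\<exists>S. seg p q S \<and> eqv p q (p, y) (p, hd S)")
      case False
      then obtain z where z: "eqv p q (p, y) (p, z)" "reach p q p (p, z) x" "x \<noteq> q"
        using step.IH by blast
      have xx': "adj x x'" "x' \<noteq> p" "short (d p x + d p x' + 1)" using step.hyps by auto
      obtain s y0 ys where c: "s \<in> {p, q}" "adj s y0" "vwalk y0 ys x" "set ys \<inter> {p, q} = {}" "length ys + d p s = d p x"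
        using canonical_dart[OF V(1,2) _ reach_V[OF z(2)] reach_notin[OF z(2)]] by (metis insertI1)
      have l: "link p q (p, z) (s, y0)" using reach_canonical[OF V(1,2) _ z(2) c] by simp
      have "s \<noteq> q" using l link_seg False z(1) by metis
      then have s: "s = p" using c(1) by simp
      have e: "eqv p q (p, y) (p, y0)" using z(1) l s link_eqv eqv_trans by blast
      have hy: "hd ys = y0" using c(3) by (simp add: vwalk_def)
      show ?thesis
      proof (cases "x' = q")
        case True
        have "seg p q ys"
          using segI[OF c(3), of p q] c s True xx' by (simp add: add.commute)
        then show ?thesis using e hy by blast
      next
        case x'q: False
        have "reach p q p (p, y0) x'"
          using reachI[OF vwalk_snoc[OF c(3) xx'(1)], of p q p p] c s x'q xx'
          by (simp add: add.commute)
        then show ?thesis using e x'q by blast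
      qed
    qed blast
  qed
  from this[OF chain] show ?thesis using that by blast
qed

lemma dart_seg:
  assumes V: "p \<in> V" "q \<in> V" "p \<noteq> q" and sh: "short (2 * d p q)" and y: "dart p q \<delta>"
  obtains S where "seg p q S" "eqv p q \<delta> (p, hd S)"
proof (cases "fst \<delta> = p")
  case True
  then show ?thesis using dart_seg_left[OF V sh, of "snd \<delta>"] y that
    by (metis dart_def prod.collapse)
next
  case False
  have q: "\<delta> = (q, snd \<delta>)" "adj q (snd \<delta>)" "snd \<delta> \<notin> {q, p}"
    using y False by (auto simp: dart_def prod_eq_iff)
  obtain S where S: "seg q p S" "eqv q p (q, snd \<delta>) (q, hd S)"
    using dart_seg_left[OF V(2,1) not_sym[OF V(3)] _ q(2,3)] sh d_sym[OF V(1,2)] by metis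
  have S0: "S \<noteq> []" using segD(1)[OF S(1)] .
  have "eqv p q (q, hd S) (p, hd (rev S))"
    using link_eqv[OF link_sym[OF seg_link[OF seg_rev[OF S(1)]]]] S0 by (simp add: last_rev)
  then show ?thesis using that[OF seg_rev[OF S(1)]] S(2) q(1) eqv_swap[of p q] eqv_trans by metis
qed

text \<open>Every class at \<open>{a, b}\<close> contains a segment. By
  \<open>crossing_no_bypass\<close> it meets \<open>v\<close> or \<open>w\<close>, and by
  \<open>seg_share\<close> it belongs to the class of the arc through that vertex.\<close>

lemma crossing_two_classes:
  assumes c: "crossing v w a b A1 A2 B1 B2" and \<delta>: "dart a b \<delta>"
  shows "eqv a b \<delta> (a, hd (rev A1 @ [v])) \<or> eqv a b \<delta> (a, hd (A2 @ [w]))"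
proof -
  note V = crossing_V[OF c] and fs = crossing_flip_seg[OF c]
  have ab: "a \<noteq> b" using crossing_disjoint[OF c] by auto
  have "2 * d a b \<le> length A1 + length A2 + length B1 + length B2 + 4"
    using d_le[OF crossing_flip_walks(1)[OF c], of "length A1 + length B1 + 2"]
      d_le[OF crossing_flip_walks(2)[OF c], of "length A2 + length B2 + 2"] by simp
  then have "short (2 * d a b)" using c short_mono unfolding crossing_def by blast
  then obtain S where S: "seg a b S" "eqv a b \<delta> (a, hd S)" using dart_seg V ab \<delta> by metis
  have "vwalk a (a # S @ [b]) b" "short (length (a # S @ [b]) - 1 + d a b)"
    using S(1) by (auto simp: seg_def)
  then have "set (a # S @ [b]) \<inter> {v, w} \<noteq> {}" using crossing_no_bypass[OF c] by blast
  then have "v \<in> set S \<or> w \<in> set S" using c by (auto simp: crossing_def)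
  then have "eqv a b (a, hd S) (a, hd (rev A1 @ v # B1)) \<or> eqv a b (a, hd S) (a, hd (A2 @ w # rev B2))"
    using seg_share[OF S(1) fs(1)] seg_share[OF S(1) fs(2)] by auto
  then show ?thesis
    unfolding hd_append_Cons[of _ v B1] hd_append_Cons[of _ w "rev B2"] using S(2) eqv_trans by blast
qed

text \<open>A separator has two inequivalent darts, while \<open>crossing_two_classes\<close> leaves
  room for two classes only. So the arcs through \<open>v\<close> and through \<open>w\<close>
  represent different classes.\<close>

lemma crossing_flip:
  assumes c: "crossing v w a b A1 A2 B1 B2" and s: "sep a b"
  shows "crossing a b v w (rev A1) B1 A2 (rev B2)"
proof -
  note cD = c[unfolded crossing_def]
  obtain \<delta> \<epsilon> where "dart a b \<delta>" "dart a b \<epsilon>" "\<not> eqv a b \<delta> \<epsilon>" using s by (auto simp: sep_def)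
  then have "\<not> eqv a b (a, hd (rev A1 @ [v])) (a, hd (A2 @ [w]))"
    using crossing_two_classes[OF c] by (meson eqv_sym eqv_trans)
  then show ?thesis unfolding crossing_def
    using cD crossing_flip_walks[OF c] crossing_disjoint[OF c] by (auto elim!: short_mono)
qed

lemma crossing_seg_hits:
  assumes c: "crossing v w a b A1 A2 B1 B2" and s: "sep a b" and T: "seg v w T"
  shows "a \<in> set T \<or> b \<in> set T"
proof (rule ccontr)
  assume n: "\<not> ?thesis"
  have "vwalk v (v # T @ [w]) w" "short (length (v # T @ [w]) - 1 + d v w)"
    using T by (auto simp: seg_def)
  moreover have "set (v # T @ [w]) \<inter> {a, b} = {}" using n c by (auto simp: crossing_def)
  ultimately show False using crossing_no_bypass[OF crossing_flip[OF c s]] by blast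
qed

text \<open>If \<open>T\<close> met \<open>b\<close> instead, \<open>seg_share\<close> would put it
  into the class of the other side.\<close>

lemma crossing_seg_hits_side:
  assumes c: "crossing v w a b A1 A2 B1 B2" and s: "sep a b" and T: "seg v w T"
    and e: "eqv v w (v, hd T) (v, hd (A1 @ [a]))"
  shows "a \<in> set T"
proof (rule ccontr)
  assume "a \<notin> set T"
  then have "b \<in> set T" using crossing_seg_hits[OF c s T] by blast
  then have "eqv v w (v, hd T) (v, hd (B1 @ b # B2))"
    using seg_share[OF T crossing_seg(2)[OF c]] by auto
  then have "eqv v w (v, hd (A1 @ [a])) (v, hd (B1 @ [b]))"
    using e eqv_sym eqv_trans hd_append_Cons[of B1 b B2] by metis
  then show False using c by (auto simp: crossing_def)
qed

end

section \<open>Cycles split by crossing pairs\<close>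

context short_graph_2con begin

text \<open>A link at \<open>{v, z}\<close> that starts on the side of \<open>z\<close> cannot
  escape: it avoids \<open>w\<close>, and if it ends in \<open>z\<close>, also \<open>u\<close>. So
  a link back to \<open>v\<close> is a link at \<open>{v, w}\<close> as well, and a link to
  \<open>z\<close> can be compared at \<open>{z, u}\<close> with the arc from \<open>z\<close> to
  \<open>v\<close>.\<close>

lemma diagonal_link:
  assumes c: "crossing v w z u A1 A2 B1 B2" and s: "sep z u"
    and e: "eqv v w (v, y) (v, hd (A1 @ [z]))" and l: "link v z (v, y) (t, y')"
  shows "t = v \<and> eqv v w (v, y') (v, hd (A1 @ [z])) \<or>
         t = z \<and> eqv z u (z, y') (z, hd (rev A1 @ [v]))"
proof -
  note cD = c[unfolded crossing_def] and V = crossing_V[OF c] and dis = crossing_disjoint[OF c]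
  have nvw: "\<not> adj v w" using crossing_not_adj[OF crossing_flip[OF c s]] .
  obtain xs where xs: "vwalk y xs y'" "set xs \<inter> {v, z} = {}" "short (length xs + 1 + d v t)"
    "adj v y" "adj t y'" "t \<in> {v, z}"
    using l by (auto simp: link_def)
  have cA: "vwalk v (v # A1 @ z # A2 @ [w]) w" and cB: "vwalk v (v # B1 @ u # B2 @ [w]) w" using cD by auto
  have wA: "vwalk v ((v # A1) @ [z]) z" "vwalk z (z # A2 @ [w]) w"
    using vwalk_split[of v "v # A1" z "A2 @ [w]" w] cA by auto
  have wB: "vwalk v ((v # B1) @ [u]) u" "vwalk u (u # B2 @ [w]) w"
    using vwalk_split[of v "v # B1" u "B2 @ [w]" w] cB by auto
  have tV: "t \<in> V" using xs(5) adj_V by blast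
  \<comment> \<open>Up to its first visit of \<open>w\<close> the walk would be a segment on the
    side of \<open>z\<close> and hence contain \<open>z\<close>.\<close>
  have w: "w \<notin> set xs"
  proof
    assume "w \<in> set xs"
    then obtain X1 X2 where X: "xs = X1 @ w # X2" "w \<notin> set X1" by (meson split_list_first)
    have "X1 \<noteq> []" using xs(1,4) X nvw by (auto simp: vwalk_def)
    then have w1: "vwalk y X1 (last X1)" "adj (last X1) w"
      using xs(1) X by (auto simp: vwalk_def successively_append_iff)
    have w2: "vwalk w (w # X2 @ [t]) t"
      using vwalk_snoc[OF vwalk_split(2)[OF xs(1)[unfolded X(1)]] adj_sym[OF xs(5)]] by simp
    have "d v w \<le> d v t + d w t" using d_triangle[OF V(1) tV V(2)] d_sym V tV by simp
    moreover have "d w t \<le> length X2 + 1" using d_le[OF w2] by simp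
    ultimately have "length X1 + 1 + d v w \<le> length xs + 1 + d v t" using X by simp
    then have "seg v w X1"
      using segI[OF w1(1) xs(4) w1(2)] xs(2) X cD short_mono[OF xs(3)] by auto
    moreover have "hd X1 = y" using w1(1) by (simp add: vwalk_def)
    ultimately have "z \<in> set X1" using crossing_seg_hits_side[OF c s] e by metis
    then show False using xs(2) X by auto
  qed
  show ?thesis
  proof (cases "t = v")
    case True
    have "link v w (v, y) (v, y')"
      using linkI[OF xs(1) _ xs(4) adj_sym[OF xs(5)]] xs(2,3) w True by auto
    then show ?thesis using True e link_eqv eqv_sym eqv_trans by blast
  next
    case False
    then have t: "t = z" using xs(6) by simp
    \<comment> \<open>Otherwise \<open>(v, y)\<close> and the first dart towards \<open>u\<close>
      both reach \<open>u\<close> from \<open>v\<close>, which identifies the two sides.\<close>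
    have u: "u \<notin> set xs"
    proof
      assume "u \<in> set xs"
      then obtain X1 X2 where X: "xs = X1 @ u # X2" by (meson split_list)
      have w1: "vwalk y (X1 @ [u]) u" and w2: "vwalk u (u # X2 @ [z]) z"
        using vwalk_split[OF xs(1)[unfolded X(1)]] vwalk_snoc[OF vwalk_split(2)[OF xs(1)[unfolded X(1)]] adj_sym[OF xs(5)]] t
        by auto
      have "d v u \<le> d v z + d u z" using d_triangle[OF V(1) V(3) V(4)] d_sym[OF V(3,4)] by simp
      then have "length (X1 @ [u]) + d v v + d v u \<le> length xs + 1 + d v t"
        using d_le[OF w2, of "length X2 + 1"] X t by simp
      then have r1: "reach v w v (v, y) u"
        using reachI[OF w1 _ xs(4)] short_mono[OF xs(3)] xs(2) w X cD by auto
      have "d v u \<le> length A1 + length A2 + length B2 + 3"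
        using d_triangle[OF V(1,2,4)] crossing_seg(3)[OF c] d_le[OF wB(2), of "length B2 + 1"] d_sym[OF V(2,4)]
        by simp
      then have "length (B1 @ [u]) + d v v + d v u \<le> length A1 + length A2 + length B1 + length B2 + 4"
        by simp
      then have r2: "reach v w v (v, hd (B1 @ [u])) u"
        using reachI[of "hd (B1 @ [u])" "B1 @ [u]" u v w v v] wB(1) short_mono cD
        by (auto simp: vwalk_def successively_Cons)
      have "eqv v w (v, hd (A1 @ [z])) (v, hd (B1 @ [u]))"
        using reach_eqv[OF V(1,2) _ r1 r2] e eqv_sym eqv_trans by blast
      then show False using cD by simp
    qed
    \<comment> \<open>Reversed and extended to \<open>v\<close>, the walk avoids
      \<open>{z, u}\<close>, and so does the reversed arc \<open>A1\<close>. Both reach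
      \<open>v\<close> from the anchor \<open>z\<close>.\<close>
    have r1: "reach z u z (z, y') v"
      using reachI[OF vwalk_snoc[OF vwalk_rev[OF xs(1)] adj_sym[OF xs(4)]], of z u z z] xs t u cD d_sym[OF V(1,3)]
      by (auto elim!: short_mono)
    have "d v z \<le> length A2 + length B1 + length B2 + 3"
      using d_triangle[OF V(1,2,3)] crossing_seg(4)[OF c] d_le[OF wA(2), of "length A2 + 1"] d_sym[OF V(2,3)]
      by simp
    then have "length (rev A1 @ [v]) + d z z + d z v \<le> length A1 + length A2 + length B1 + length B2 + 4"
      using d_sym[OF V(1,3)] by simp
    then have r2: "reach z u z (z, hd (rev A1 @ [v])) v"
      using reachI[of "hd (rev A1 @ [v])" "rev A1 @ [v]" v z u z z] vwalk_rev[OF wA(1)] short_mono cD dis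
      by (auto simp: vwalk_def successively_Cons)
    have "eqv z u (z, y') (z, hd (rev A1 @ [v]))" using reach_eqv[OF V(3,4) _ r1 r2] by blast
    then show ?thesis using t by blast
  qed
qed

text \<open>The darts at \<open>v\<close> on the side of \<open>z\<close> together with the darts at \<open>z\<close> on the side of \<open>v\<close> are closed under
  linkage with respect to \<open>{v, z}\<close>.\<close>

lemma diagonal_not_eqv:
  assumes c: "crossing v w z u A1 A2 B1 B2" and s: "sep v w" "sep z u"
    and e: "eqv v w (v, y) (v, hd (A1 @ [z]))"
  shows "\<not> eqv v z (v, y) (v, hd (B1 @ [u]))"
proof
  assume h: "eqv v z (v, y) (v, hd (B1 @ [u]))"
  define I where "I \<delta> \<longleftrightarrow> fst \<delta> = v \<and> eqv v w \<delta> (v, hd (A1 @ [z])) \<or>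
     fst \<delta> = z \<and> eqv z u \<delta> (z, hd (rev A1 @ [v]))" for \<delta>
  note f = crossing_flip[OF c s(2)]
  have "(link v z)\<^sup>*\<^sup>* (v, y) (v, hd (B1 @ [u]))" using h by (simp add: eqv_def)
  then have "I (v, hd (B1 @ [u]))"
  proof (induction)
    case base
    then show ?case using e by (simp add: I_def)
  next
    case (step \<delta> \<epsilon>)
    show ?case
    proof (cases "fst \<delta> = v \<and> eqv v w \<delta> (v, hd (A1 @ [z]))")
      case True
      then show ?thesis
        using diagonal_link[OF c s(2), of "snd \<delta>" "fst \<epsilon>" "snd \<epsilon>"] step(2)
        unfolding I_def by (metis prod.collapse)
    next
      case False
      then have "fst \<delta> = z" "eqv z u \<delta> (z, hd (rev A1 @ [v]))" using step(3) by (auto simp: I_def)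
      \<comment> \<open>The flipped crossing exchanges \<open>v\<close> with \<open>z\<close> and
        \<open>w\<close> with \<open>u\<close>, so the second alternative of \<open>I\<close> is the
        first one for the flip.\<close>
      then show ?thesis
        using diagonal_link[OF f s(1), of "snd \<delta>" "fst \<epsilon>" "snd \<epsilon>"] step(2) link_swap[of z v]
        unfolding I_def rev_rev_ident by (metis prod.collapse)
    qed
  qed
  moreover have "v \<noteq> z" using c by (auto simp: crossing_def)
  ultimately have "eqv v w (v, hd (B1 @ [u])) (v, hd (A1 @ [z]))" by (simp add: I_def)
  then show False using c eqv_sym by (auto simp: crossing_def)
qed

text \<open>The closed walk of a crossing may repeat vertices; this is a genuine cycle. No crossing
  pair is fixed, because the descent keeps choosing new ones.\<close>

definition split_cycle :: "'v \<Rightarrow> 'v \<Rightarrow> 'v list \<Rightarrow> 'v list \<Rightarrow> bool" where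
  "split_cycle v w S T \<longleftrightarrow> sep v w \<and> S \<noteq> [] \<and> T \<noteq> [] \<and> distinct (v # w # S @ T) \<and>
     vwalk v (v # S @ [w]) w \<and> vwalk v (v # T @ [w]) w \<and> short (length S + length T + 2) \<and>
     \<not> eqv v w (v, hd S) (v, hd T)"

lemma split_cycle_segs:
  assumes "split_cycle v w S T" shows "seg v w S" "seg v w T"
proof -
  note sD = assms[unfolded split_cycle_def]
  have "d v w \<le> length S + 1" "d v w \<le> length T + 1"
    using d_le[of v "v # S @ [w]" w "length S + 1"] d_le[of v "v # T @ [w]" w "length T + 1"] sD by auto
  then show "seg v w S" "seg v w T" using sD by (auto simp: seg_def elim!: short_mono)
qed

end

section \<open>Graphs in which every separator is crossed\<close>

locale all_crossed_graph = short_graph_2con V adj short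
  for V :: "'v set" and adj short +
  assumes all_crossed: "sep v w \<Longrightarrow> \<exists>a b A1 A2 B1 B2. sep a b \<and> crossing v w a b A1 A2 B1 B2"
begin

text \<open>A crossed separator crosses back, and a crossing pair is never adjacent, since its edge
  would be a bypass.\<close>

lemma sep_not_adj: "sep v w \<Longrightarrow> \<not> adj v w"
  using all_crossed crossing_flip crossing_not_adj by blast

text \<open>There are only two classes at \<open>{v, w}\<close>, so \<open>S\<close> and
  \<open>T\<close> match the two sides of the crossing, and each contains the vertex of the crossing
  pair on its side. The walks of the crossing can then be replaced by the arcs of the cycle.\<close>

lemma split_cycle_crossed:
  assumes sc: "split_cycle v w S T"
  obtains z u A1 A2 B1 B2 where "S = A1 @ z # A2" "T = B1 @ u # B2" "sep z u"
    "crossing v w z u A1 A2 B1 B2"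
proof -
  note sD = sc[unfolded split_cycle_def] and sg = split_cycle_segs[OF sc]
  have sv: "sep v w" using sD by simp
  obtain a b A1 A2 B1 B2 where s: "sep a b" and c: "crossing v w a b A1 A2 B1 B2"
    using all_crossed[OF sv] by blast
  note c' = crossing_swap[OF c] and s' = sep_swap[OF s]
  have dS: "dart v w (v, hd S)" "dart v w (v, hd T)"
    using segD(3,5)[OF sg(1)] segD(3,5)[OF sg(2)] sD by (auto simp: dart_def disjoint_iff)
  note tc = crossing_two_classes[OF crossing_flip[OF c s], unfolded rev_rev_ident]
  have "a \<in> set S \<and> b \<in> set T \<or> b \<in> set S \<and> a \<in> set T"
  proof (cases "eqv v w (v, hd S) (v, hd (A1 @ [a]))")
    case True
    then have "eqv v w (v, hd T) (v, hd (B1 @ [b]))" using tc[OF dS(2)] sD eqv_sym eqv_trans by blast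
    then show ?thesis using crossing_seg_hits_side[OF c s sg(1) True] crossing_seg_hits_side[OF c' s' sg(2)]
      by blast
  next
    case False
    then have 1: "eqv v w (v, hd S) (v, hd (B1 @ [b]))" using tc[OF dS(1)] by blast
    then have "eqv v w (v, hd T) (v, hd (A1 @ [a]))" using tc[OF dS(2)] sD eqv_sym eqv_trans by blast
    then show ?thesis using crossing_seg_hits_side[OF c' s' sg(1) 1] crossing_seg_hits_side[OF c s sg(2)]
      by blast
  qed
  then obtain z u where zu: "z \<in> set S" "u \<in> set T" "sep z u" using s s' by blast
  obtain C1 C2 D1 D2 where S: "S = C1 @ z # C2" and T: "T = D1 @ u # D2"
    using zu by (meson split_list)
  have "crossing v w z u C1 C2 D1 D2"
    unfolding crossing_def using sD hd_append_Cons[of C1 z C2] hd_append_Cons[of D1 u D2]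
    by (auto simp: S T elim!: short_mono)
  then show ?thesis using that S T zu by blast
qed

lemma crossing_split_cycle:
  assumes c: "crossing v w z u A1 A2 B1 B2" and "sep v w" "distinct (v # w # (A1 @ z # A2) @ (B1 @ u # B2))"
  shows "split_cycle v w (A1 @ z # A2) (B1 @ u # B2)"
  unfolding split_cycle_def
  using assms crossing_seg[OF c] hd_append_Cons[of A1 z A2] hd_append_Cons[of B1 u B2]
  by (auto simp: crossing_def elim!: short_mono)

text \<open>\<open>v\<close> stays fixed while each step replaces \<open>w\<close> by
  \<open>z\<close> and the crossing pair by one whose first vertex lies on \<open>A1\<close>, before
  \<open>z\<close>. Once \<open>z\<close> is adjacent to \<open>v\<close>, flipping the crossing
  puts \<open>z\<close> in the role of \<open>v\<close>; this gives the second conclusion, which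
  allows the argument to move on to the next vertex.\<close>

lemma side_neighbour:
  assumes "crossing v w z u A1 A2 B1 B2" "sep v w" "sep z u"
    "distinct (v # w # (A1 @ z # A2) @ (B1 @ u # B2))"
    "adj v y" "eqv v w (v, y) (v, hd (A1 @ [z]))"
  shows "y = hd (A1 @ [z]) \<and> (\<exists>x S T. split_cycle (hd (A1 @ [z])) x S T)"
  using assms
proof (induction "length A1" arbitrary: w z u A1 A2 B1 B2 rule: less_induct)
  case less
  note c = less.prems(1) and s = less.prems(2,3) and dist = less.prems(4) and y = less.prems(5,6)
  note cD = c[unfolded crossing_def] and f = crossing_flip[OF c s(2)] and V = crossing_V[OF c]
  \<comment> \<open>The remainder of the cycle, from \<open>v\<close> through \<open>u\<close> and
    \<open>w\<close> to \<open>z\<close>.\<close>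
  let ?T = "B1 @ u # rev (A2 @ w # rev B2)"
  have w1: "vwalk v ((v # A1) @ [z]) z" "vwalk z (z # A2 @ [w]) w"
    using vwalk_split[of v "v # A1" z "A2 @ [w]" w] cD by auto
  have adjh: "adj v (hd (B1 @ [u]))"
    using segD(3)[OF crossing_seg(2)[OF c]] hd_append_Cons[of B1 u B2] by simp
  have dh: "dart v z (v, hd (B1 @ [u]))" using adjh dist by (cases B1) (auto simp: dart_def)
  have w2: "vwalk v (v # ?T @ [z]) z"
    using vwalk_join[of v "v # B1 @ u # B2 @ [w]" w "rev (z # A2 @ [w])" z] vwalk_rev[OF w1(2)] cD by simp
  have "d v z \<le> length A1 + 1" "d v z \<le> length A2 + length B1 + length B2 + 3"
    using d_le[OF w1(1), of "length A1 + 1"] d_le[OF w2, of "length A2 + length B1 + length B2 + 3"] by auto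
  then have sh: "short (2 * d v z)" using cD by (auto elim!: short_mono)
  \<comment> \<open>\<open>diagonal_not_eqv\<close> separates \<open>(v, x)\<close> from the first
    dart towards \<open>u\<close>, and \<open>x \<noteq> z\<close> makes it a dart at
    \<open>{v, z}\<close>.\<close>
  have sepI: "sep v z" if "adj v x" "x \<noteq> z" "eqv v w (v, x) (v, hd (A1 @ [z]))" for x
  proof -
    have "dart v z (v, x)" using that adj_irrefl by (auto simp: dart_def)
    then show ?thesis using dh sh V cD diagonal_not_eqv[OF c s that(3)] unfolding sep_def by auto
  qed
  show ?case
  proof (cases "A1 = []")
    case True
    then have "adj v z" using w1(1) by (auto simp: vwalk_def)
    \<comment> \<open>Otherwise \<open>{v, z}\<close> would be a separator with adjacent
      vertices.\<close>
    then have "y = z" using sepI[OF y(1) _ y(2)] sep_not_adj by blast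
    moreover have "split_cycle z u (rev A1 @ v # B1) (A2 @ w # rev B2)"
      using crossing_split_cycle[OF f s(2)] dist by auto
    ultimately show ?thesis using True by auto
  next
    case False
    then have h: "hd (A1 @ [z]) = hd A1" "hd A1 \<in> set A1" by auto
    have a: "adj v (hd A1)" using w1(1) False by (auto simp: vwalk_def successively_Cons)
    have sep: "sep v z" using sepI[OF a] h dist eqv_refl by auto
    have ne1: "\<not> eqv v z (v, hd A1) (v, hd (B1 @ [u]))"
      using diagonal_not_eqv[OF c s] h eqv_refl by metis
    have ne2: "\<not> eqv v z (v, y) (v, hd (B1 @ [u]))" using diagonal_not_eqv[OF c s y(2)] .
    have hT: "hd ?T = hd (B1 @ [u])" by (cases B1) auto
    have sc: "split_cycle v z A1 ?T"
      unfolding split_cycle_def hT using sep False dist w1(1) w2 ne1 cD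
      by (auto simp: add.commute add.left_commute elim!: short_mono)
    obtain p q C1 C2 D1 D2 where n: "A1 = C1 @ p # C2" "?T = D1 @ q # D2" "sep p q"
        "crossing v z p q C1 C2 D1 D2"
      using split_cycle_crossed[OF sc] by metis
    have hC: "hd (C1 @ [p]) = hd A1" using n(1) hd_append_Cons by metis
    have hD: "hd (D1 @ [q]) = hd (B1 @ [u])" using n(2) hd_append_Cons hT by metis
    have "y \<noteq> z" using sep sep_not_adj y(1) by blast
    then have "dart v z (v, y)" using y(1) adj_irrefl by (auto simp: dart_def)
    \<comment> \<open>There are only two classes at \<open>{v, z}\<close>, and \<open>y\<close> is
      not on the side of \<open>?T\<close>; so it lies on the side of the new vertex
      \<open>p\<close>.\<close>
    then have "eqv v z (v, y) (v, hd (C1 @ [p]))"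
      using crossing_two_classes[OF crossing_flip[OF n(4,3)]] ne2 hD by auto
    moreover have "distinct (v # z # (C1 @ p # C2) @ D1 @ q # D2)"
      using sc unfolding split_cycle_def n(1,2) by simp
    ultimately show ?thesis using less.hyps[OF _ n(4) sep n(3) _ y(1)] n(1) hC h by auto
  qed
qed

lemma split_cycle_neighbours:
  assumes sc: "split_cycle v w S T"
  shows "adj v y \<Longrightarrow> y = hd S \<or> y = hd T"
    "\<exists>x S' T'. split_cycle (hd S) x S' T'" "\<exists>x S' T'. split_cycle (hd T) x S' T'"
proof -
  obtain z u A1 A2 B1 B2 where S: "S = A1 @ z # A2" and T: "T = B1 @ u # B2" and s: "sep z u"
    and c: "crossing v w z u A1 A2 B1 B2" using split_cycle_crossed[OF sc] by metis
  have sv: "sep v w" and dist: "distinct (v # w # (A1 @ z # A2) @ (B1 @ u # B2))"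
    using sc by (auto simp: split_cycle_def S T)
  have dist': "distinct (v # w # (B1 @ u # B2) @ (A1 @ z # A2))" using dist by auto
  note c' = crossing_swap[OF c] and s' = sep_swap[OF s]
  have h: "hd (A1 @ [z]) = hd S" "hd (B1 @ [u]) = hd T" using hd_append_Cons S T by metis+
  have a: "adj v (hd S)" "adj v (hd T)" using segD(3) split_cycle_segs[OF sc] by auto
  show "\<exists>x S' T'. split_cycle (hd S) x S' T'" "\<exists>x S' T'. split_cycle (hd T) x S' T'"
    using side_neighbour[OF c sv s dist a(1)] side_neighbour[OF c' sv s' dist' a(2)] h eqv_refl by auto
  assume y: "adj v y"
  have "dart v w (v, y)" using y sep_not_adj[OF sv] adj_irrefl by (auto simp: dart_def)
  then have "eqv v w (v, y) (v, hd (A1 @ [z])) \<or> eqv v w (v, y) (v, hd (B1 @ [u]))"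
    using crossing_two_classes[OF crossing_flip[OF c s]] by simp
  then show "y = hd S \<or> y = hd T"
    using side_neighbour[OF c sv s dist y] side_neighbour[OF c' sv s' dist' y] h by auto
qed

lemma seg_shortcut:
  assumes "seg p q (X @ y # Y @ y # Z)"
  shows "seg p q (X @ y # Z)"
proof -
  have "vwalk p ((p # X) @ y # (Y @ y # Z @ [q])) q" "vwalk p ((p # X @ y # Y) @ y # (Z @ [q])) q"
    using assms by (auto simp: seg_def)
  then have "vwalk p ((p # X) @ [y]) y" "vwalk y (y # Z @ [q]) q" by (blast dest: vwalk_split)+
  from vwalk_join[OF this] show ?thesis using assms by (auto simp: seg_def elim!: short_mono)
qed

text \<open>A shortest cycle that is split by \<open>{v, w}\<close> has no repeated vertices.\<close>

lemma sep_split_cycle: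
  assumes sv: "sep v w"
  shows "\<exists>S T. split_cycle v w S T"
proof -
  let ?P = "\<lambda>(S, T). seg v w S \<and> seg v w T \<and> short (length S + length T + 2) \<and> \<not> eqv v w (v, hd S) (v, hd T)"
  obtain a b A1 A2 B1 B2 where c: "crossing v w a b A1 A2 B1 B2" using all_crossed[OF sv] by blast
  have "?P (A1 @ a # A2, B1 @ b # B2)"
    using crossing_seg(1,2)[OF c] c hd_append_Cons[of A1 a A2] hd_append_Cons[of B1 b B2]
    by (auto simp: crossing_def elim!: short_mono)
  from ex_has_least_nat[of ?P, OF this, of "\<lambda>(S, T). length S + length T"]
  obtain S T where P: "?P (S, T)" and min: "\<And>S' T'. ?P (S', T') \<Longrightarrow> length S + length T \<le> length S' + length T'"
    by auto
  have dS: "distinct S"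
  proof (rule ccontr)
    assume "\<not> distinct S"
    then obtain X y Y Z where S: "S = X @ y # Y @ y # Z" using not_distinct_decomp by fastforce
    \<comment> \<open>Cutting out a closed part keeps the first vertex and hence the class of the
      segment.\<close>
    have "?P (X @ y # Z, T)"
      using P seg_shortcut[of v w X y Y Z] hd_append_Cons[of X y Z] hd_append_Cons[of X y "Y @ y # Z"]
      by (auto simp: S elim: short_mono)
    from min[OF this] show False by (simp add: S)
  qed
  have dT: "distinct T"
  proof (rule ccontr)
    assume "\<not> distinct T"
    then obtain X y Y Z where T: "T = X @ y # Y @ y # Z" using not_distinct_decomp by fastforce
    have "?P (S, X @ y # Z)"
      using P seg_shortcut[of v w X y Y Z] hd_append_Cons[of X y Z] hd_append_Cons[of X y "Y @ y # Z"]
      by (auto simp: T elim: short_mono)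
    from min[OF this] show False by (simp add: T)
  qed
  \<comment> \<open>Minimality is not what excludes a common vertex: by \<open>seg_share\<close> it
    would make the two arcs equivalent.\<close>
  have "set S \<inter> set T = {}"
  proof (rule equals0I)
    fix x assume "x \<in> set S \<inter> set T"
    then show False using P seg_share[of v w S T x] by auto
  qed
  moreover have "v \<noteq> w" using sv by (simp add: sep_def)
  ultimately have "split_cycle v w S T"
    using P sv dS dT unfolding split_cycle_def seg_def by auto
  then show ?thesis by blast
qed

text \<open>The neighbours of such a vertex are the first vertices of its two arcs and have the
  property again, so it spreads along walks.\<close>

lemma all_split_cycle:
  assumes "sep v w" "x \<in> V"
  shows "\<exists>x' S T. split_cycle x x' S T"
proof -
  have "v \<in> V" using assms by (simp add: sep_def)
  then have "adj\<^sup>*\<^sup>* v x" using connected assms by blast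
  then show ?thesis
  proof (induction)
    case base
    then show ?case using sep_split_cycle[OF assms(1)] by blast
  next
    case (step y z)
    then show ?case using split_cycle_neighbours by metis
  qed
qed

text \<open>Every vertex has at most two neighbours. A vertex of the cycle has two on the cycle
  already, so no walk leaves the cycle.\<close>

theorem cycle_if_sep:
  assumes sv: "sep v w"
  shows "\<exists>xs. distinct xs \<and> 3 \<le> length xs \<and> short (length xs) \<and> V = set xs \<and>
    (\<forall>i < length xs. adj (xs ! i) (xs ! (Suc i mod length xs))) \<and>
    (\<forall>x y. adj x y \<longrightarrow> (\<exists>i < length xs. {x, y} = {xs ! i, xs ! (Suc i mod length xs)}))"
proof -
  obtain S T where sc: "split_cycle v w S T" using sep_split_cycle[OF sv] by blast
  note sD = sc[unfolded split_cycle_def]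
  define xs where "xs = v # S @ w # rev T"
  define n where "n = length xs"
  have n: "3 \<le> n" using sD by (cases S; cases T) (auto simp: n_def xs_def)
  have dist: "distinct xs" using sD by (auto simp: xs_def)
  have sh: "short n" using sD by (auto simp: n_def xs_def elim!: short_mono)
  have suc: "successively adj (xs @ [v])"
    using vwalk_join[of v "v # S @ [w]" w "rev (v # T @ [w])" v] vwalk_rev[of v "v # T @ [w]" w] sD
    by (auto simp: vwalk_def xs_def)
  have adj: "adj (xs ! i) (xs ! (Suc i mod n))" if "i < n" for i
  proof (cases "Suc i = n")
    case True
    then have "(xs @ [v]) ! i = xs ! i" "(xs @ [v]) ! Suc i = xs ! (Suc i mod n)"
      by (auto simp: n_def nth_append) (simp add: xs_def)
    then show ?thesis using successively_nth[OF suc, of i] that by (simp add: n_def)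
  next
    case False
    then show ?thesis using successively_nth[OF suc, of i] that
      by (auto simp: n_def nth_append)
  qed
  have two: "\<exists>a b. \<forall>y. adj x y \<longrightarrow> y = a \<or> y = b" if "x \<in> V" for x
    using all_split_cycle[OF sv that] split_cycle_neighbours(1) by metis
  have inV: "xs ! i \<in> V" if "i < n" for i using adj[OF that] adj_V by blast
  have nb: "y = xs ! (Suc i mod n) \<or> y = xs ! ((i + n - 1) mod n)" if i: "i < n" and y: "adj (xs ! i) y" for i y
  proof -
    let ?j = "(i + n - 1) mod n"
    have j: "?j < n" using n by simp
    have sj: "Suc ?j mod n = i" using i n by (cases "i = 0") (auto simp: mod_Suc_eq)
    have a1: "adj (xs ! i) (xs ! (Suc i mod n))" using adj i by blast
    have a2: "adj (xs ! i) (xs ! ?j)" using adj[OF j] sj adj_sym by simp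
    \<comment> \<open>Since \<open>n\<close> is at least three, predecessor and successor on the
      cycle differ and thus exhaust the neighbours.\<close>
    have "Suc i mod n \<noteq> ?j"
    proof (cases "i = 0")
      case True then show ?thesis using n by simp
    next
      case False
      then have "?j = i - 1" using i n by (simp add: mod_if)
      then show ?thesis using i n False by (auto simp: mod_Suc)
    qed
    moreover have "Suc i mod n < n" using n by simp
    ultimately have "xs ! (Suc i mod n) \<noteq> xs ! ?j"
      using j nth_eq_iff_index_eq[OF dist, of "Suc i mod n" ?j] unfolding n_def by simp
    then show ?thesis using two[OF inV[OF i]] a1 a2 y by metis
  qed
  have edge: "\<exists>i < n. {x, y} = {xs ! i, xs ! (Suc i mod n)}" if xy: "adj x y" "x \<in> set xs" for x y
  proof -
    obtain i where i: "i < n" "x = xs ! i" using xy(2) by (auto simp: in_set_conv_nth n_def)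
    let ?j = "(i + n - 1) mod n"
    have j: "?j < n" using n by simp
    have sj: "Suc ?j mod n = i" using i n by (cases "i = 0") (auto simp: mod_Suc_eq)
    from nb[OF i(1)] xy(1) i(2) consider "y = xs ! (Suc i mod n)" | "y = xs ! ?j" by blast
    then show ?thesis
    proof cases
      case 1 then show ?thesis using i by blast
    next
      case 2
      then have "{x, y} = {xs ! ?j, xs ! (Suc ?j mod n)}" using sj i by auto
      then show ?thesis using j by blast
    qed
  qed
  have "x \<in> set xs" if "x \<in> V" for x
  proof -
    have "v \<in> V" using sv by (simp add: sep_def)
    then have "adj\<^sup>*\<^sup>* v x" using connected that by blast
    then show ?thesis
    proof (induction)
      case base show ?case by (simp add: xs_def)
    next
      case (step y z)
      from edge[OF step(2,3)] obtain i where "i < n" "{y, z} = {xs ! i, xs ! (Suc i mod n)}" by blast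
      moreover have "0 < n" using n by simp
      ultimately show ?case
        by (metis doubleton_eq_iff mod_less_divisor n_def nth_mem)
    qed
  qed
  then have V: "V = set xs" using inV by (auto simp: in_set_conv_nth n_def)
  show ?thesis
    by (intro exI[of _ xs] conjI)
      (use dist n sh V adj edge adj_V in \<open>auto simp: n_def\<close>)
qed

end

section \<open>Walks and balls in multigraphs\<close>

definition step :: "('v, 'e) mgraph \<Rightarrow> 'v \<Rightarrow> 'v \<Rightarrow> bool" where
  "step H x y \<longleftrightarrow> x \<in> verts H \<and> y \<in> verts H \<and> (\<exists>e \<in> edges H. ends H e = {x, y})"

text \<open>Loops change neither distances nor components, so the abstract graph is loopless;
  multiplicities are already forgotten by \<open>step\<close>.\<close>

definition sadj :: "('v, 'e) mgraph \<Rightarrow> 'v \<Rightarrow> 'v \<Rightarrow> bool" where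
  "sadj H x y \<longleftrightarrow> x \<noteq> y \<and> step H x y"

lemma step_sym: "step H x y \<Longrightarrow> step H y x"
  by (auto simp: step_def insert_commute)

lemma is_walk_single: "is_walk H ([x], es) \<longleftrightarrow> es = [] \<and> x \<in> verts H"
  by (auto simp: is_walk_def)

lemma is_walk_Cons:
  "is_walk H (x # y # xs, e # es) \<longleftrightarrow>
     x \<in> verts H \<and> e \<in> edges H \<and> ends H e = {x, y} \<and> is_walk H (y # xs, es)"
  by (auto simp: is_walk_def All_less_Suc2)

lemma not_is_walk_Nil: "\<not> is_walk H (x # y # xs, [])"
  by (simp add: is_walk_def)

lemma is_walk_induct [consumes 1, case_names single Cons]:
  assumes "is_walk H (xs, es)"
    and "\<And>x. x \<in> verts H \<Longrightarrow> P [x] []"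
    and "\<And>x y xs e es. x \<in> verts H \<Longrightarrow> e \<in> edges H \<Longrightarrow> ends H e = {x, y} \<Longrightarrow>
           is_walk H (y # xs, es) \<Longrightarrow> P (y # xs) es \<Longrightarrow> P (x # y # xs) (e # es)"
  shows "P xs es"
  using assms(1)
proof (induction es arbitrary: xs)
  case Nil
  then obtain x where "xs = [x]" by (cases xs) (auto simp: is_walk_def)
  then show ?case using Nil assms(2) by (auto simp: is_walk_def)
next
  case (Cons e es)
  then obtain x y ys where "xs = x # y # ys"
    by (cases xs; cases "tl xs") (auto simp: is_walk_def)
  then show ?case using Cons assms(3) by (auto simp: is_walk_Cons)
qed

lemma is_walk_hd: "is_walk H (y # xs, es) \<Longrightarrow> y \<in> verts H"
  by (auto simp: is_walk_def)

lemma walk_steps: "is_walk H (xs, es) \<Longrightarrow> (step H)\<^sup>*\<^sup>* (hd xs) (last xs)"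
proof (induction rule: is_walk_induct)
  case (Cons x y xs e es)
  then have "step H x y" using is_walk_hd by (auto simp: step_def)
  then show ?case using Cons by (auto intro: converse_rtranclp_into_rtranclp)
qed simp

lemma walk_suffix: "is_walk H (xs @ y # ys, es) \<Longrightarrow> \<exists>es'. is_walk H (y # ys, es')"
proof (induction xs arbitrary: es)
  case (Cons x xs)
  then show ?case by (cases es; cases xs) (auto simp: is_walk_Cons not_is_walk_Nil)
qed auto

lemma steps_path:
  assumes "(step H)\<^sup>*\<^sup>* u v" "v \<in> verts H"
  shows "\<exists>xs es. is_walk H (xs, es) \<and> distinct xs \<and> hd xs = u \<and> last xs = v"
  using assms(1)
proof (induction rule: converse_rtranclp_induct)
  case base
  have "is_walk H ([v], [])" using assms by (simp add: is_walk_single)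
  then show ?case by fastforce
next
  case (step y z)
  then obtain xs es where xs: "is_walk H (xs, es)" "distinct xs" "hd xs = z" "last xs = v" by blast
  show ?case
  proof (cases "y \<in> set xs")
    case True
    then obtain as bs where s: "xs = as @ y # bs" by (meson split_list)
    then show ?thesis using walk_suffix[of H as y bs es] xs by force
  next
    case False
    obtain e where e: "e \<in> edges H" "ends H e = {y, z}" "y \<in> verts H" using step(1) by (auto simp: step_def)
    obtain ys where ys: "xs = z # ys" using xs by (cases xs) (auto simp: is_walk_def)
    then have "is_walk H (y # xs, e # es)" using xs e by (simp add: is_walk_Cons)
    then show ?thesis using xs False ys by fastforce
  qed
qed

lemma joined_iff: "joined H u v \<longleftrightarrow> u \<in> verts H \<and> v \<in> verts H \<and> (step H)\<^sup>*\<^sup>* u v"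
proof
  assume "joined H u v"
  then obtain xs es where p: "is_walk H (xs, es)" "hd xs = u" "last xs = v"
    by (auto simp: joined_def walk_betw_def)
  then have "xs \<noteq> []" "set xs \<subseteq> verts H" by (auto simp: is_walk_def)
  then show "u \<in> verts H \<and> v \<in> verts H \<and> (step H)\<^sup>*\<^sup>* u v" using walk_steps[OF p(1)] p by auto
next
  assume "u \<in> verts H \<and> v \<in> verts H \<and> (step H)\<^sup>*\<^sup>* u v"
  then show "joined H u v" using steps_path[of H u v] unfolding joined_def walk_betw_def by fastforce
qed

lemma joined_refl: "x \<in> verts H \<Longrightarrow> joined H x x"
  by (simp add: joined_iff)

lemma joined_sym: "joined H x y \<Longrightarrow> joined H y x"
  unfolding joined_iff by (metis step_sym sympD sympI symp_rtranclp)

lemma joined_trans: "joined H x y \<Longrightarrow> joined H y z \<Longrightarrow> joined H x z"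
  unfolding joined_iff by auto

lemma joined_step: "step H x y \<Longrightarrow> joined H x y"
  unfolding joined_iff using step_def r_into_rtranclp by metis

lemma step_sadj: "(step H)\<^sup>*\<^sup>* x y \<Longrightarrow> (sadj H)\<^sup>*\<^sup>* x y"
proof (induction rule: rtranclp_induct)
  case (step y z)
  then show ?case by (cases "y = z") (auto simp: sadj_def intro: rtranclp.rtrancl_into_rtrancl)
qed simp

lemma step_del_verts:
  "step (del_verts H X) x y \<longleftrightarrow> step H x y \<and> x \<notin> X \<and> y \<notin> X"
  by (auto simp: step_def del_verts_def induced_def)

lemma verts_del_verts: "verts (del_verts H X) = verts H - X"
  by (auto simp: del_verts_def induced_def)

locale connected_mgraph =
  fixes G :: "('v, 'e) mgraph" and r :: enat
  assumes mgraph: "mgraph G" and connected_graph: "connected_graph G"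

sublocale connected_mgraph \<subseteq> short_graph "verts G" "sadj G" "\<lambda>n. enat n \<le> r"
proof
  show "sadj G y x" if "sadj G x y" for x y using that step_sym by (auto simp: sadj_def)
  show "\<not> sadj G x x" for x by (simp add: sadj_def)
  show "x \<in> verts G" if "sadj G x y" for x y using that by (simp add: sadj_def step_def)
  show "(sadj G)\<^sup>*\<^sup>* x y" if "x \<in> verts G" "y \<in> verts G" for x y
    using connected_graph that step_sadj unfolding connected_graph_def joined_iff by metis
  show "enat m \<le> r" if "enat n \<le> r" "m \<le> n" for m n using that by (meson enat_ord_simps(1) order_trans)
qed

context connected_mgraph begin

abbreviation shrt :: "nat \<Rightarrow> bool" where
  "shrt n \<equiv> enat n \<le> r"

lemma edge_ends:
  assumes "e \<in> edges G"
  obtains x y where "x \<in> verts G" "y \<in> verts G" "ends G e = {x, y}"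
  using assms mgraph by (auto simp: mgraph_def)

lemma edge_verts: "e \<in> edges G \<Longrightarrow> ends G e \<subseteq> verts G"
  by (erule edge_ends) simp

lemma edge_step: "e \<in> edges G \<Longrightarrow> ends G e = {x, y} \<Longrightarrow> step G x y"
  using edge_verts[of e] unfolding step_def by (metis insert_subset)

lemma walk_vwalk:
  assumes "is_walk G (xs, es)"
  shows "\<exists>ys. vwalk (hd xs) ys (last xs) \<and> length ys \<le> Suc (length es)"
  using assms
proof (induction rule: is_walk_induct)
  case (single x)
  then show ?case using vwalk_self by fastforce
next
  case (Cons x y xs e es)
  then obtain ys where ys: "vwalk y ys (last (y # xs))" "length ys \<le> Suc (length es)" by auto
  show ?case
  proof (cases "x = y")
    case True
    then show ?thesis using ys by (intro exI[of _ ys]) auto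
  next
    case False
    then have "sadj G x y" using edge_step Cons by (simp add: sadj_def)
    then have "vwalk x (x # ys) (last (y # xs))" using vwalk_Cons ys by blast
    then show ?thesis using ys by (intro exI[of _ "x # ys"]) auto
  qed
qed

lemma vwalk_walk:
  assumes "vwalk x xs y" "x \<in> verts G"
  shows "\<exists>es. is_walk G (xs, es) \<and> length xs = Suc (length es)"
  using assms
proof (induction xs arbitrary: x)
  case Nil
  then show ?case by (simp add: vwalk_def)
next
  case (Cons a xs)
  show ?case
  proof (cases xs)
    case Nil
    then show ?thesis using Cons.prems by (auto simp: is_walk_single vwalk_def)
  next
    case (Cons b ys)
    have a: "a = x" "sadj G x b" "vwalk b xs y" using Cons.prems(1) Cons by (auto simp: vwalk_def)
    then obtain es where es: "is_walk G (xs, es)" "length xs = Suc (length es)"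
      using Cons.IH adj_V2 by blast
    obtain e where "e \<in> edges G" "ends G e = {x, b}" using a by (auto simp: sadj_def step_def)
    then have "is_walk G (a # xs, e # es)"
      using es Cons a Cons.prems by (simp add: is_walk_Cons)
    then show ?thesis using es by force
  qed
qed

lemma gdist_eq_d:
  assumes "x \<in> verts G" "y \<in> verts G"
  shows "gdist G x y = enat (d x y)"
proof (rule antisym)
  obtain xs where xs: "vwalk x xs y" "length xs = Suc (d x y)" using geodesic assms by blast
  then obtain es where "is_walk G (xs, es)" "length xs = Suc (length es)" using vwalk_walk assms by blast
  then have "walk_betw G x (xs, es) y" "wlength (xs, es) = d x y"
    using xs by (auto simp: walk_betw_def vwalk_def wlength_def)
  then show "gdist G x y \<le> enat (d x y)"
    unfolding gdist_def by (metis INF_lower mem_Collect_eq)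
  have "d x y \<le> wlength p" if p: "walk_betw G x p y" for p
  proof -
    obtain xs es where "p = (xs, es)" by fastforce
    with p walk_vwalk obtain ys where "vwalk x ys y" "length ys \<le> Suc (wlength p)"
      by (fastforce simp: walk_betw_def wlength_def)
    then show ?thesis using d_le by blast
  qed
  then show "enat (d x y) \<le> gdist G x y"
    unfolding gdist_def by (auto intro!: INF_greatest)
qed

lemma d_step:
  assumes "v \<in> verts G" "step G x y" shows "d v y \<le> d v x + 1"
proof (cases "x = y")
  case False
  then have "sadj G x y" using assms by (simp add: sadj_def)
  then show ?thesis using d_triangle[of v x y] d_adj[of x y] adj_V adj_V2 assms by fastforce
qed simp

lemma verts_ball:
  assumes v: "v \<in> verts G"
  shows "verts (local_ball G r v) = {x \<in> verts G. shrt (2 * d v x)}"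
proof (cases r)
  case (enat k)
  then show ?thesis
    using gdist_eq_d[OF v]
    by (auto simp: local_ball_def int_ball_def half_ball_def induced_def Let_def elim!: evenE oddE)
next
  case infinity
  then show ?thesis using gdist_eq_d[OF v] by (auto simp: local_ball_def induced_def)
qed

lemma ends_ball: "ends (local_ball G r v) = ends G"
  by (auto simp: local_ball_def int_ball_def half_ball_def induced_def Let_def split: enat.split)

lemma edges_ball_sub: "edges (local_ball G r v) \<subseteq> edges G"
  by (auto simp: local_ball_def int_ball_def half_ball_def induced_def Let_def split: enat.split)

text \<open>The ends of an edge have distances from \<open>v\<close> that differ by at most one. For
  even r, the edges removed at the boundary are those for which the sum is r + 1; for odd r, an edge
  inside has sum at most r and any edge leaving the ball has a larger one.\<close>

lemma edges_ball:
  assumes v: "v \<in> verts G" and e: "e \<in> edges G" "ends G e = {x, y}"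
  shows "e \<in> edges (local_ball G r v) \<longleftrightarrow> shrt (d v x + d v y + 1)"
proof -
  have xy: "x \<in> verts G" "y \<in> verts G" using edge_verts e by auto
  note g = gdist_eq_d[OF v xy(1)] gdist_eq_d[OF v xy(2)]
  have s: "d v x \<le> d v y + 1" "d v y \<le> d v x + 1"
    using d_step[OF v edge_step[OF e]] d_step[OF v step_sym[OF edge_step[OF e]]] by auto
  show ?thesis
  proof (cases r)
    case (enat k)
    show ?thesis
    proof (cases "even k")
      case True
      then obtain m where k: "k = 2 * m" by (elim evenE)
      have "e \<in> edges (local_ball G r v) \<longleftrightarrow>
          d v x \<le> m \<and> d v y \<le> m \<and> \<not> (d v x = m \<and> d v y = m)"
        using e xy g enat k by (auto simp: local_ball_def int_ball_def induced_def Let_def)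
      also have "\<dots> \<longleftrightarrow> d v x + d v y + 1 \<le> k" using s k by auto
      finally show ?thesis using enat by simp
    next
      case False
      then obtain m where k: "k = 2 * m + 1" by (elim oddE)
      have "e \<in> edges (local_ball G r v) \<longleftrightarrow> d v x \<le> m \<and> d v y \<le> m"
        using e xy g enat k by (auto simp: local_ball_def half_ball_def induced_def Let_def)
      also have "\<dots> \<longleftrightarrow> d v x + d v y + 1 \<le> k" using s k by auto
      finally show ?thesis using enat by simp
    qed
  next
    case infinity
    then show ?thesis using e xy g by (auto simp: local_ball_def induced_def)
  qed
qed

lemma step_ball:
  assumes v: "v \<in> verts G"
  shows "step (local_ball G r v) x y \<longleftrightarrow> step G x y \<and> shrt (d v x + d v y + 1)"
proof
  assume a: "step (local_ball G r v) x y"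
  then obtain e where "e \<in> edges (local_ball G r v)" "ends G e = {x, y}"
    by (auto simp: step_def ends_ball)
  then show "step G x y \<and> shrt (d v x + d v y + 1)"
    using edges_ball[OF v] edges_ball_sub edge_step by blast
next
  assume a: "step G x y \<and> shrt (d v x + d v y + 1)"
  then obtain e where e: "e \<in> edges G" "ends G e = {x, y}" by (auto simp: step_def)
  have "d v x \<le> d v y + 1" "d v y \<le> d v x + 1" using d_step[OF v, of x y] d_step[OF v, of y x] step_sym[of G x y] a by blast+
  then have "shrt (2 * d v x)" "shrt (2 * d v y)" using a by (auto elim!: short_mono)
  then show "step (local_ball G r v) x y"
    using a e edges_ball[OF v e] verts_ball[OF v] by (auto simp: step_def ends_ball)
qed

lemma ball_connected_if_locally_2_connected:
  assumes l: "locally_2_connected r G" and v: "v \<in> verts G"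
    and x: "x \<in> verts G" "y \<in> verts G" "x \<noteq> v" "y \<noteq> v" "shrt (2 * d v x)" "shrt (2 * d v y)"
  shows "(\<lambda>a b. sadj G a b \<and> a \<noteq> v \<and> b \<noteq> v \<and> shrt (d v a + d v b + 1))\<^sup>*\<^sup>* x y"
proof -
  let ?R = "\<lambda>a b. sadj G a b \<and> a \<noteq> v \<and> b \<noteq> v \<and> shrt (d v a + d v b + 1)"
  have "\<not> local_cutvertex r G v" using l by (simp add: locally_2_connected_def)
  then have "joined (del_verts (local_ball G r v) {v}) x y"
    using v x verts_ball[OF v]
    by (auto simp: local_cutvertex_def disconnected_graph_def verts_del_verts)
  then have "(step (del_verts (local_ball G r v) {v}))\<^sup>*\<^sup>* x y" by (simp add: joined_iff)
  then show ?thesis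
  proof (induction)
    case (step a b)
    show ?case
    proof (cases "a = b")
      case False
      then have "?R a b" using step(2) by (auto simp: step_del_verts step_ball[OF v] sadj_def)
      then show ?thesis using step(3) by (rule rtranclp.rtrancl_into_rtrancl[rotated])
    qed (use step in simp)
  qed simp
qed

end

section \<open>Components of the punctured explorer-neighbourhood\<close>

lemma is_walk_take:
  assumes "is_walk H (xs, es)" "i < length xs"
  shows "is_walk H (take (Suc i) xs, take i es)"
  using assms set_take_subset[of "Suc i" xs] set_take_subset[of i es] by (auto simp: is_walk_def)

lemma is_walk_drop:
  assumes "is_walk H (xs, es)" "i < length xs"
  shows "is_walk H (drop i xs, drop i es)"
  using assms set_drop_subset[of i xs] set_drop_subset[of i es] by (auto simp: is_walk_def)

lemma shortest_paths_iff:
  "p \<in> shortest_paths H C u \<longleftrightarrow> path_from H C p u \<and> (\<forall>q. path_from H C q u \<longrightarrow> wlength p \<le> wlength q)"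
  unfolding shortest_paths_def mem_Collect_eq ..

lemma shortest_pathsD:
  assumes "p \<in> shortest_paths H C u"
  shows "path_from H C p u" "path_from H C q u \<Longrightarrow> wlength p \<le> wlength q"
  using assms unfolding shortest_paths_iff by blast+

lemma shortest_pathsI:
  assumes "path_from H C p u" "\<And>q. path_from H C q u \<Longrightarrow> wlength p \<le> wlength q"
  shows "p \<in> shortest_paths H C u"
  unfolding shortest_paths_iff by (rule conjI[OF assms(1)], intro allI impI, rule assms(2))

lemma shortest_paths_nonempty:
  assumes "(step H)\<^sup>*\<^sup>* c x" "x \<in> verts H" "c \<in> C"
  shows "shortest_paths H C x \<noteq> {}"
proof -
  obtain xs es where "is_walk H (xs, es)" "distinct xs" "hd xs = c" "last xs = x"
    using steps_path assms by metis
  then have "path_from H C (xs, es) x" using assms by (simp add: path_from_def is_path_def)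
  from ex_has_least_nat[of "\<lambda>p. path_from H C p x", OF this, of wlength]
  obtain p where "p \<in> shortest_paths H C x" unfolding shortest_paths_iff by (elim exE)
  then show ?thesis by auto
qed

lemma path_from_shape:
  assumes "path_from H C (xs, es) x"
  shows "wlength (xs, es) = 0 \<Longrightarrow> \<exists>y. xs = [y]" "wlength (xs, es) = 1 \<Longrightarrow> \<exists>y z. xs = [y, z]"
proof -
  have "length xs = Suc (wlength (xs, es))"
    using assms by (simp add: path_from_def is_path_def is_walk_def wlength_def)
  then show "wlength (xs, es) = 0 \<Longrightarrow> \<exists>y. xs = [y]" "wlength (xs, es) = 1 \<Longrightarrow> \<exists>y z. xs = [y, z]"
    by (auto simp: length_Suc_conv)
qed

lemma shortest_paths_trivial:
  fixes H :: "('v, 'e) mgraph"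
  assumes "x \<in> C" "x \<in> verts H"
  shows "shortest_paths H C x = {([x], [])}"
proof -
  have p: "path_from H C ([x], []) x"
    using assms by (simp add: path_from_def is_path_def is_walk_single)
  have triv: "p = ([x], [])" if a: "path_from H C p x" "wlength p = 0" for p
  proof -
    obtain xs es where pe: "p = (xs, es)" by fastforce
    obtain y where "xs = [y]" using path_from_shape(1) a pe by metis
    then show ?thesis using a pe by (simp add: path_from_def wlength_def)
  qed
  show ?thesis
  proof (rule subset_antisym; rule subsetI)
    fix p assume q: "p \<in> shortest_paths H C x"
    have "wlength p = 0" using shortest_pathsD(2)[OF q p] by (simp add: wlength_def)
    from triv[OF shortest_pathsD(1)[OF q] this] show "p \<in> {([x], [])}" by simp
  next
    fix p :: "('v, 'e) walk" assume "p \<in> {([x], [])}"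
    then have q: "p = ([x], [])" by (rule singletonD)
    show "p \<in> shortest_paths H C x"
      unfolding q by (rule shortest_pathsI[OF p]) (simp add: wlength_def)
  qed
qed

text \<open>The label of a neighbour of the core is just its set of edges from the core, so equality
  of two labels only depends on which of these edges lie in the balls.\<close>

lemma shortest_paths_edges:
  assumes z: "z \<notin> C" "z \<in> verts H"
    and c: "c \<in> C" "c \<in> verts H" "e \<in> edges H" "ends H e = {c, z}"
  shows "shortest_paths H C z =
    {([c, z], [e]) | c e. c \<in> C \<and> c \<in> verts H \<and> e \<in> edges H \<and> ends H e = {c, z}}"
proof -
  have p: "path_from H C ([c, z], [e]) z"
    if "c \<in> C" "c \<in> verts H" "e \<in> edges H" "ends H e = {c, z}" for c e
    using that z by (auto simp: path_from_def is_path_def is_walk_Cons is_walk_single)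
  have n0: "wlength p \<noteq> 0" if b: "path_from H C p z" for p
  proof
    assume a: "wlength p = 0"
    obtain xs es where pe: "p = (xs, es)" by fastforce
    obtain y where "xs = [y]" using path_from_shape(1) b pe a by metis
    then show False using b pe z by (auto simp: path_from_def)
  qed
  have n1: "\<exists>c e. p = ([c, z], [e]) \<and> c \<in> C \<and> c \<in> verts H \<and> e \<in> edges H \<and> ends H e = {c, z}"
    if a: "path_from H C p z" "wlength p = 1" for p
  proof -
    obtain xs es where pe: "p = (xs, es)" by fastforce
    obtain e where "es = [e]" using a(2) pe by (auto simp: wlength_def length_Suc_conv)
    moreover obtain x y where "xs = [x, y]" using path_from_shape(2) a pe by metis
    ultimately show ?thesis
      using a(1) pe by (simp add: path_from_def is_path_def is_walk_Cons is_walk_single)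
  qed
  show ?thesis
  proof (intro set_eqI iffI)
    fix p assume q: "p \<in> shortest_paths H C z"
    have "path_from H C p z" "wlength p \<le> wlength ([c, z], [e])"
      using shortest_pathsD(1)[OF q] shortest_pathsD(2)[OF q p[OF c]] .
    moreover from this have "wlength p = 1" using n0[of p] by (simp add: wlength_def le_Suc_eq)
    ultimately show "p \<in> {([c, z], [e]) | c e. c \<in> C \<and> c \<in> verts H \<and> e \<in> edges H \<and> ends H e = {c, z}}"
      using n1[of p] by simp
  next
    fix p assume "p \<in> {([c, z], [e]) | c e. c \<in> C \<and> c \<in> verts H \<and> e \<in> edges H \<and> ends H e = {c, z}}"
    then have "path_from H C p z" "wlength p = 1" using p by (auto simp: wlength_def)
    moreover have "1 \<le> wlength q" if "path_from H C q z" for q using n0[OF that] by simp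
    ultimately show "p \<in> shortest_paths H C z" by (intro shortest_pathsI) simp_all
  qed
qed

context connected_mgraph begin

lemma geodesic_distinct:
  assumes "vwalk x xs y" "length xs = Suc (d x y)"
  shows "distinct xs"
proof (rule ccontr)
  assume "\<not> distinct xs"
  then obtain X a Y Z where s: "xs = X @ a # Y @ a # Z" using not_distinct_decomp by fastforce
  have "vwalk x (X @ [a]) a" "vwalk a (a # Z) y"
    using vwalk_split(1)[of x X a "Y @ a # Z" y] vwalk_split(2)[of x "X @ a # Y" a Z y] assms(1) s by auto
  from d_le[OF vwalk_join[OF this], of "length X + length Z"] show False using assms(2) s by simp
qed

lemma walk_d_le: "is_walk G (xs, es) \<Longrightarrow> d (hd xs) (last xs) \<le> length es"
  using walk_vwalk d_le by blast

lemma shortest_path_length: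
  assumes V: "x \<in> verts G" "y \<in> verts G" and p: "p \<in> shortest_paths G {x} y"
  shows "wlength p = d x y"
proof -
  obtain xs where xs: "vwalk x xs y" "length xs = Suc (d x y)" using geodesic V by blast
  then obtain es where es: "is_walk G (xs, es)" "length xs = Suc (length es)" using vwalk_walk V by blast
  have "path_from G {x} (xs, es) y"
    using es xs geodesic_distinct[OF xs] by (auto simp: path_from_def is_path_def vwalk_def)
  then have "wlength p \<le> wlength (xs, es)" by (rule shortest_pathsD(2)[OF p])
  then have "wlength p \<le> d x y" using es(2) xs(2) by (simp add: wlength_def)
  moreover have "d x y \<le> wlength p"
    using shortest_pathsD(1)[OF p] walk_d_le[of "fst p" "snd p"]
    by (auto simp: path_from_def is_path_def wlength_def)
  ultimately show ?thesis by simp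
qed

text \<open>The two parts of a shortest path bound the distances from above, the triangle inequality
  from below. This equation and the membership of both ends are all that is kept of the
  core.\<close>

lemma core_dist:
  assumes V: "x \<in> verts G" "y \<in> verts G" and c: "c \<in> core G x y"
  shows "c \<in> verts G" "d x c + d c y = d x y"
proof -
  obtain xs es where p: "(xs, es) \<in> shortest_paths G {x} y" "c \<in> set xs"
    using c by (auto simp: core_def)
  then have w: "is_walk G (xs, es)" "hd xs = x" "last xs = y"
    using shortest_pathsD(1)[OF p(1)] by (auto simp: path_from_def is_path_def)
  show cV: "c \<in> verts G" using w(1) p(2) by (auto simp: is_walk_def)
  obtain i where i: "i < length xs" "xs ! i = c" using p(2) by (auto simp: in_set_conv_nth)
  have l: "length xs = Suc (length es)" using w(1) by (simp add: is_walk_def)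
  have "last (take (Suc i) xs) = c" using i by (simp add: take_Suc_conv_app_nth)
  then have "d x c \<le> i"
    using walk_d_le[OF is_walk_take[OF w(1) i(1)]] w(2) i(1) by simp
  moreover have "d c y \<le> length es - i"
    using walk_d_le[OF is_walk_drop[OF w(1) i(1)]] w(3) i by (simp add: hd_drop_conv_nth)
  moreover have "length es = d x y" using shortest_path_length[OF V p(1)] by (simp add: wlength_def)
  moreover have "d x y \<le> d x c + d c y" using d_triangle V cV by blast
  ultimately show "d x c + d c y = d x y" using i l by simp
qed

lemma core_ends:
  assumes V: "x \<in> verts G" "y \<in> verts G"
  shows "x \<in> core G x y" "y \<in> core G x y"
proof -
  have "(step G)\<^sup>*\<^sup>* x y" using connected_graph V by (auto simp: connected_graph_def joined_iff)
  then obtain xs es where p: "(xs, es) \<in> shortest_paths G {x} y"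
    using shortest_paths_nonempty[of G x y "{x}"] V by auto
  then have "xs \<noteq> []" "hd xs = x" "last xs = y"
    using shortest_pathsD(1)[OF p] by (auto simp: path_from_def is_path_def is_walk_def)
  then have "x \<in> set xs" "y \<in> set xs" by auto
  then show "x \<in> core G x y" "y \<in> core G x y" using p unfolding core_def by (auto intro!: bexI[OF _ p])
qed

text \<open>The last edge of a geodesic to \<open>x\<close> closes up at \<open>s\<close> to length
  \<open>2 * d s x\<close>, so it lies in the ball. Consequently labels are nonempty if the centre
  is in the core.\<close>

lemma ball_steps:
  assumes "s \<in> verts G" "x \<in> verts (local_ball G r s)"
  shows "(step (local_ball G r s))\<^sup>*\<^sup>* s x"
  using assms(2)
proof (induction "d s x" arbitrary: x)
  case 0
  then have "s = x" using d_pos[OF assms(1), of x] verts_ball[OF assms(1)] by force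
  then show ?case by simp
next
  case (Suc n)
  have xV: "x \<in> verts G" and sh: "shrt (2 * d s x)" using Suc.prems verts_ball[OF assms(1)] by auto
  obtain xs where xs: "vwalk s xs x" "length xs = Suc (d s x)" using geodesic assms(1) xV by blast
  obtain ys where ys: "xs = ys @ [x]" using xs(1) by (metis append_butlast_last_id vwalk_def)
  have ne: "ys \<noteq> []" using xs ys Suc.hyps by auto
  have y: "vwalk s ys (last ys)" "sadj G (last ys) x"
    using xs(1) ys ne by (auto simp: vwalk_def successively_append_iff)
  have "d s (last ys) \<le> n" using d_le[OF y(1), of n] xs(2) ys Suc.hyps by simp
  moreover have "d s x \<le> d s (last ys) + 1" using d_step[OF assms(1)] y(2) by (auto simp: sadj_def)
  ultimately have dn: "d s (last ys) = n" using Suc.hyps by simp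
  have st: "step (local_ball G r s) (last ys) x"
    using y(2) dn Suc.hyps(2) sh by (auto simp: step_ball[OF assms(1)] sadj_def elim!: short_mono)
  then have "last ys \<in> verts (local_ball G r s)" by (simp add: step_def)
  from Suc.hyps(1)[OF dn[symmetric] this] st show ?case by auto
qed

end

text \<open>The set \<open>C\<close> stands for the core; then \<open>H\<close> and \<open>P\<close> below are the explorer-neighbourhood and its
  punctured version.\<close>

locale close_pair = connected_mgraph G r for G :: "('v, 'e) mgraph" and r +
  fixes v w :: 'v and C :: "'v set"
  assumes v_in: "v \<in> verts G" and w_in: "w \<in> verts G" and v_neq_w: "v \<noteq> w"
    and close: "shrt (2 * d v w)"
    and core_on: "c \<in> C \<Longrightarrow> c \<in> verts G \<and> d v c + d c w = d v w"
    and core_v: "v \<in> C" and core_w: "w \<in> C"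
begin

abbreviation ball :: "'v \<Rightarrow> ('v, 'e) mgraph" where
  "ball s \<equiv> local_ball G r s"

definition lab :: "'v \<Rightarrow> 'v \<Rightarrow> ('v, 'e) copy" where
  "lab s x = labelled (ball s) C x"

definition H :: "(('v, 'e) copy, 'e \<times> ('v, 'e) copy set) mgraph" where
  "H = \<lparr>verts = verts (labelled_copy (ball v) C) \<union> verts (labelled_copy (ball w) C),
        edges = edges (labelled_copy (ball v) C) \<union> edges (labelled_copy (ball w) C), ends = snd\<rparr>"

definition P :: "(('v, 'e) copy, 'e \<times> ('v, 'e) copy set) mgraph" where
  "P = del_verts H (copies_of {v, w})"

lemma fst_lab: "fst (lab s x) = x"
  by (simp add: lab_def labelled_def)

lemma centre_V: "s \<in> {v, w} \<Longrightarrow> s \<in> verts G"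
  using v_in w_in by auto

lemma d_core:
  assumes "s \<in> {v, w}" "t \<in> {v, w}" "s \<noteq> t" "c \<in> C"
  shows "d s c + d t c = d v w" "d s t = d v w"
  using core_on[OF assms(4)] assms(1-3) d_sym v_in w_in by auto

lemma verts_H: "c \<in> verts H \<longleftrightarrow> (\<exists>s \<in> {v, w}. \<exists>a \<in> verts (ball s). c = lab s a)"
  by (auto simp: H_def labelled_copy_def lab_def)

lemma step_H: "step H c c' \<longleftrightarrow> (\<exists>s \<in> {v, w}. \<exists>a b. step (ball s) a b \<and> c = lab s a \<and> c' = lab s b)"
proof
  assume a: "step H c c'"
  then obtain e where e: "e \<in> edges H" "snd e = {c, c'}" by (auto simp: step_def H_def)
  then have "\<exists>s \<in> {v, w}. \<exists>f \<in> edges (ball s). lab s ` ends G f = {c, c'}"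
    by (auto simp: H_def labelled_copy_def lab_def[abs_def] ends_ball)
  then obtain s f where s: "s \<in> {v, w}" "f \<in> edges (ball s)" "lab s ` ends G f = {c, c'}"
    by blast
  have fG: "f \<in> edges G" using s(2) edges_ball_sub by blast
  then obtain a b where ab: "ends G f = {a, b}" using edge_ends by metis
  have "shrt (d s a + d s b + 1)" using edges_ball[OF centre_V[OF s(1)] fG ab] s(2) by simp
  then have "step (ball s) a b" using step_ball[OF centre_V[OF s(1)]] edge_step[OF fG ab] by simp
  moreover have "{lab s a, lab s b} = {c, c'}" using s(3) ab by simp
  ultimately show "\<exists>s \<in> {v, w}. \<exists>a b. step (ball s) a b \<and> c = lab s a \<and> c' = lab s b"
    using s(1) step_sym by (metis doubleton_eq_iff)
next
  assume "\<exists>s \<in> {v, w}. \<exists>a b. step (ball s) a b \<and> c = lab s a \<and> c' = lab s b"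
  then obtain s a b where s: "s \<in> {v, w}" "step (ball s) a b" "c = lab s a" "c' = lab s b" by blast
  then obtain f where f: "f \<in> edges (ball s)" "ends (ball s) f = {a, b}" by (auto simp: step_def)
  have "(f, lab s ` ends (ball s) f) \<in> edges H"
    using s(1) f(1) by (auto simp: H_def labelled_copy_def lab_def[abs_def])
  moreover have "ends H (f, lab s ` ends (ball s) f) = {c, c'}" using f s by (simp add: H_def)
  moreover have "c \<in> verts H" "c' \<in> verts H" using s by (auto simp: verts_H step_def)
  ultimately show "step H c c'" unfolding step_def by blast
qed

lemma verts_P: "c \<in> verts P \<longleftrightarrow> c \<in> verts H \<and> fst c \<notin> {v, w}"
  by (auto simp: P_def verts_del_verts copies_of_def)

lemma step_P: "step P c c' \<longleftrightarrow> step H c c' \<and> fst c \<notin> {v, w} \<and> fst c' \<notin> {v, w}"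
  by (auto simp: P_def step_del_verts copies_of_def)

text \<open>All edges between the core and \<open>z\<close> lie in both balls, so these edges form both labels.\<close>

lemma label_eq:
  assumes st: "s \<in> {v, w}" "t \<in> {v, w}" "s \<noteq> t" and z: "z \<notin> {v, w}" "sadj G t z"
    and sh: "shrt (d s t + d s z + 1)"
  shows "lab s z = lab t z"
proof -
  note sV = centre_V[OF st(1)] and tV = centre_V[OF st(2)]
  have zV: "z \<in> verts G" using adj_V2 z(2) by blast
  have dst: "d s t = d v w" using d_core[OF st core_v] by simp
  have "0 < d s t" "0 < d s z" using d_pos sV tV zV st z(1) by auto
  then have s3: "shrt 3" using short_mono[OF sh] by simp
  have dsz: "d s z \<le> d s t + 1" using d_step[OF sV] z(2) by (simp add: sadj_def)
  have dtz: "d t z \<le> 1" using d_adj z(2) by blast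
  have zs: "z \<in> verts (ball s)" using zV sh dsz by (auto simp: verts_ball[OF sV] elim!: short_mono)
  have zt: "z \<in> verts (ball t)" using zV dtz s3 by (auto simp: verts_ball[OF tV] elim!: short_mono)
  have cs: "c \<in> verts (ball s)" "c \<in> verts (ball t)" if "c \<in> C" for c
  proof -
    have "c \<in> verts G" "d s c + d t c = d v w" using core_on d_core(1)[OF st] that by auto
    then show "c \<in> verts (ball s)" "c \<in> verts (ball t)"
      using close by (auto simp: verts_ball[OF sV] verts_ball[OF tV] elim!: short_mono)
  qed
  have es: "e \<in> edges (ball s)" "e \<in> edges (ball t)"
    if c: "c \<in> C" and e: "e \<in> edges G" "ends G e = {c, z}" for c e
  proof -
    have cV: "c \<in> verts G" and dc: "d s c + d t c = d v w" using core_on d_core(1)[OF st] c by auto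
    \<comment> \<open>A core vertex other than \<open>t\<close> is strictly closer to
      \<open>s\<close> than \<open>t\<close> is, so the bound for \<open>t\<close> suffices.\<close>
    have "shrt (d s c + d s z + 1)"
    proof (cases "c = t")
      case False
      then have "0 < d t c" using d_pos tV cV by blast
      then show ?thesis using sh dc dst by (auto elim!: short_mono)
    qed (use sh in simp)
    then show "e \<in> edges (ball s)" using edges_ball[OF sV e] by simp
    \<comment> \<open>The 3 covers \<open>d v w = 1\<close>; for larger distances
      \<open>d v w + 2\<close> is at most \<open>2 * d v w\<close>.\<close>
    have "d t c + d t z + 1 \<le> max 3 (2 * d v w)" using dc dtz by auto
    then have "shrt (d t c + d t z + 1)" using s3 close short_mono by (metis max_def)
    then show "e \<in> edges (ball t)" using edges_ball[OF tV e] by simp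
  qed
  have "shortest_paths (ball s) C z = shortest_paths (ball t) C z"
  proof (cases "z \<in> C")
    case True
    then show ?thesis using shortest_paths_trivial zs zt by metis
  next
    case False
    have tC: "t \<in> C" using st core_v core_w by auto
    obtain e where e: "e \<in> edges G" "ends G e = {t, z}" using z(2) by (auto simp: sadj_def step_def)
    have 1: "shortest_paths (ball s) C z = {([c, z], [e]) | c e. c \<in> C \<and> e \<in> edges G \<and> ends G e = {c, z}}"
      unfolding shortest_paths_edges[OF False zs tC cs(1)[OF tC] es(1)[OF tC e] e(2)[folded ends_ball[of s]]]
        ends_ball using cs es edges_ball_sub by blast
    have 2: "shortest_paths (ball t) C z = {([c, z], [e]) | c e. c \<in> C \<and> e \<in> edges G \<and> ends G e = {c, z}}"
      unfolding shortest_paths_edges[OF False zt tC cs(2)[OF tC] es(2)[OF tC e] e(2)[folded ends_ball[of t]]]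
        ends_ball using cs es edges_ball_sub by blast
    show ?thesis using 1 2 by simp
  qed
  then show ?thesis by (simp add: lab_def labelled_def)
qed

text \<open>The anchor is the centre of a ball from which the copy is taken. With the other centre
  the same vertex may have another label and another class.\<close>

definition copy_reached :: "('v, 'e) copy \<Rightarrow> 'v \<times> 'v \<Rightarrow> bool" where
  "copy_reached c \<delta> \<longleftrightarrow> (\<exists>s \<in> {v, w}. fst c \<in> verts (ball s) \<and> c = lab s (fst c) \<and> reach v w s \<delta> (fst c))"

text \<open>A geodesic from \<open>v\<close> to a core vertex serves both anchors: the closed walks
  have length at most \<open>2 * d v w\<close>.\<close>

lemma core_reach:
  assumes c: "c \<in> C" "c \<notin> {v, w}"
  obtains \<delta> where "reach v w v \<delta> c" "reach v w w \<delta> c"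
proof -
  have cV: "c \<in> verts G" and dc: "d v c + d c w = d v w" using core_on c by auto
  obtain s y ys where y: "s \<in> {v, w}" "sadj G s y" "vwalk y ys c" "set ys \<inter> {v, w} = {}" "length ys + d v s = d v c"
    using canonical_dart[OF v_in w_in _ cV c(2)] by (metis insertI1)
  have "ys \<noteq> []" using y(3) by (simp add: vwalk_def)
  \<comment> \<open>A nonempty walk from \<open>w\<close> would force \<open>d v c\<close> above
    \<open>d v w\<close>.\<close>
  then have s: "s = v" using y(1,5) dc by (cases ys) auto
  have "length ys + d v v + d v c \<le> 2 * d v w" "length ys + d w v + d w c \<le> 2 * d v w"
    using y(5) s dc d_sym[OF v_in w_in] d_sym[OF cV w_in] by auto
  then have "reach v w v (v, y) c" "reach v w w (v, y) c"
    using reachI[OF y(3,4,2,1)] short_mono[OF close] s by auto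
  then show ?thesis using that by blast
qed

text \<open>A path that belongs to both labels starts in the core and lies in both balls, so the classes seen from
  \<open>v\<close> and from \<open>w\<close> can be compared along it.\<close>

lemma common_label_reach:
  assumes p: "p \<in> shortest_paths (ball v) C x" "p \<in> shortest_paths (ball w) C x" and x: "x \<notin> {v, w}"
  obtains \<delta> \<epsilon> where "reach v w v \<delta> x" "reach v w w \<epsilon> x" "eqv v w \<delta> \<epsilon>"
proof -
  obtain xs es where pe: "p = (xs, es)" by fastforce
  have w: "is_walk (ball v) (xs, es)" "is_walk (ball w) (xs, es)" "distinct xs" "hd xs \<in> C" "last xs = x"
    using shortest_pathsD(1)[OF p(1)] shortest_pathsD(1)[OF p(2)] pe
    by (auto simp: path_from_def is_path_def)
  have l: "length xs = Suc (length es)" using w(1) by (simp add: is_walk_def)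
  \<comment> \<open>A later visit of the core would give a shorter path from the core.\<close>
  have nC: "xs ! i \<notin> {v, w}" if i: "0 < i" "i < length xs" for i
  proof
    assume "xs ! i \<in> {v, w}"
    then have "path_from (ball v) C (drop i xs, drop i es) x"
      using is_walk_drop[OF w(1) i(2)] w i core_v core_w
      by (auto simp: path_from_def is_path_def hd_drop_conv_nth)
    then have "wlength p \<le> wlength (drop i xs, drop i es)" by (rule shortest_pathsD(2)[OF p(1)])
    then show False using pe i l by (simp add: wlength_def)
  qed
  have adj: "sadj G (xs ! i) (xs ! Suc i)" "shrt (d v (xs ! i) + d v (xs ! Suc i) + 1)"
      "shrt (d w (xs ! i) + d w (xs ! Suc i) + 1)" if i: "Suc i < length xs" for i
  proof -
    have "step (ball v) (xs ! i) (xs ! Suc i)" "step (ball w) (xs ! i) (xs ! Suc i)"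
      using w(1,2) i l unfolding is_walk_def step_def by (auto intro!: bexI[of _ "es ! i"])
    then show "sadj G (xs ! i) (xs ! Suc i)" "shrt (d v (xs ! i) + d v (xs ! Suc i) + 1)"
      "shrt (d w (xs ! i) + d w (xs ! Suc i) + 1)"
      using i w(3) by (auto simp: step_ball[OF v_in] step_ball[OF w_in] sadj_def nth_eq_iff_index_eq)
  qed
  \<comment> \<open>The classes for the two anchors agree at the start, either by
    \<open>core_reach\<close> or right after leaving \<open>v\<close> or \<open>w\<close>, where the
    edge itself is the dart for both; \<open>reach_step\<close> carries the agreement along the
    path.\<close>
  have "\<exists>\<delta> \<epsilon>. reach v w v \<delta> (xs ! i) \<and> reach v w w \<epsilon> (xs ! i) \<and> eqv v w \<delta> \<epsilon>"
    if "i < length xs" "xs ! i \<notin> {v, w}" for i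
    using that
  proof (induction i)
    case 0
    then have "xs ! 0 \<in> C" using w(4) by (simp add: hd_conv_nth)
    then show ?case using core_reach[OF _ 0(2)] eqv_refl by metis
  next
    case (Suc i)
    note a = adj[OF Suc.prems(1)]
    show ?case
    proof (cases "xs ! i \<in> {v, w}")
      case True
      have "reach v w v (xs ! i, xs ! Suc i) (xs ! Suc i)" "reach v w w (xs ! i, xs ! Suc i) (xs ! Suc i)"
        using reachI[OF vwalk_self _ a(1) True] Suc.prems(2) a(2,3) by auto
      then show ?thesis using eqv_refl by blast
    next
      case False
      then obtain \<delta> \<epsilon> where h: "reach v w v \<delta> (xs ! i)" "reach v w w \<epsilon> (xs ! i)" "eqv v w \<delta> \<epsilon>"
        using Suc.IH Suc.prems by auto
      obtain \<delta>' where 1: "eqv v w \<delta> \<delta>'" "reach v w v \<delta>' (xs ! Suc i)"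
        using reach_step[OF v_in w_in _ h(1) a(1) Suc.prems(2) a(2)] by blast
      obtain \<epsilon>' where 2: "eqv v w \<epsilon> \<epsilon>'" "reach v w w \<epsilon>' (xs ! Suc i)"
        using reach_step[OF v_in w_in _ h(2) a(1) Suc.prems(2) a(3)] by blast
      show ?thesis using 1 2 h(3) eqv_sym eqv_trans by blast
    qed
  qed
  moreover have "xs ! length es = x" using w(5) l by (cases "xs = []") (auto simp: last_conv_nth)
  ultimately show ?thesis using that l x by (metis lessI)
qed

text \<open>The class of a copy is well defined: a copy taken from both balls has the same nonempty
  label in each, and \<open>common_label_reach\<close> applies to any path in it.\<close>

lemma copy_reached_eqv:
  assumes "copy_reached c \<delta>" "copy_reached c \<epsilon>"
  shows "eqv v w \<delta> \<epsilon>"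
proof -
  obtain s where s: "s \<in> {v, w}" "fst c \<in> verts (ball s)" "c = lab s (fst c)" "reach v w s \<delta> (fst c)"
    using assms(1) by (auto simp: copy_reached_def)
  obtain t where t: "t \<in> {v, w}" "fst c \<in> verts (ball t)" "c = lab t (fst c)" "reach v w t \<epsilon> (fst c)"
    using assms(2) by (auto simp: copy_reached_def)
  show ?thesis
  proof (cases "s = t")
    case True
    then show ?thesis using reach_eqv[OF v_in w_in s(1)] s(4) t(4) by blast
  next
    case False
    have n: "fst c \<notin> {v, w}" using reach_notin[OF s(4)] .
    have "snd c = shortest_paths (ball s) C (fst c)" "snd c = shortest_paths (ball t) C (fst c)"
      using arg_cong[OF s(3), of snd] arg_cong[OF t(3), of snd] by (simp_all add: lab_def labelled_def)
    moreover have "shortest_paths (ball s) C (fst c) \<noteq> {}"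
      using shortest_paths_nonempty[OF ball_steps[OF centre_V[OF s(1)] s(2)] s(2)] s(1) core_v core_w by auto
    ultimately obtain p where "p \<in> shortest_paths (ball v) C (fst c)" "p \<in> shortest_paths (ball w) C (fst c)"
      using False s(1) t(1) by auto
    then obtain \<alpha> \<beta> where ab: "reach v w v \<alpha> (fst c)" "reach v w w \<beta> (fst c)" "eqv v w \<alpha> \<beta>"
      using common_label_reach n by metis
    have "\<exists>\<phi> \<psi>. reach v w s \<phi> (fst c) \<and> reach v w t \<psi> (fst c) \<and> eqv v w \<phi> \<psi>"
    proof (cases "s = v")
      case True
      then show ?thesis using ab False t(1) by (intro exI[of _ \<alpha>] exI[of _ \<beta>]) auto
    next
      case s: False
      then show ?thesis using ab(1,2) eqv_sym[OF ab(3)] False \<open>s \<in> {v, w}\<close> t(1)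
        by (intro exI[of _ \<beta>] exI[of _ \<alpha>]) auto
    qed
    then obtain \<phi> \<psi> where "reach v w s \<phi> (fst c)" "reach v w t \<psi> (fst c)" "eqv v w \<phi> \<psi>" by blast
    then show ?thesis
      using reach_eqv[OF v_in w_in s(1) s(4)] reach_eqv[OF v_in w_in t(1) t(4)] eqv_sym eqv_trans
      by metis
  qed
qed

lemma ball_reach:
  assumes s: "s \<in> {v, w}" and x: "x \<in> verts (ball s)" "x \<notin> {v, w}"
  obtains t y ys where "t \<in> {v, w}" "sadj G t y" "vwalk y ys x" "set ys \<inter> {v, w} = {}"
    "length ys + d s t = d s x" "reach v w s (t, y) x"
proof -
  note sV = centre_V[OF s]
  have xV: "x \<in> verts G" "shrt (2 * d s x)" using x(1) by (auto simp: verts_ball[OF sV])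
  obtain t y ys where y: "t \<in> {v, w}" "sadj G t y" "vwalk y ys x" "set ys \<inter> {v, w} = {}" "length ys + d s t = d s x"
    using canonical_dart[OF v_in w_in s xV(1) x(2)] by metis
  then have "reach v w s (t, y) x" using reachI[OF y(3,4,2,1)] xV(2) by (simp add: mult_2)
  then show ?thesis using that y by blast
qed

lemma copy_reached_step:
  assumes "step P c c'" "copy_reached c \<delta>"
  obtains \<epsilon> where "copy_reached c' \<epsilon>" "eqv v w \<delta> \<epsilon>"
proof -
  obtain s a b where s: "s \<in> {v, w}" "step (ball s) a b" "c = lab s a" "c' = lab s b"
    using assms(1) unfolding step_P step_H by blast
  have n: "a \<notin> {v, w}" "b \<notin> {v, w}" using assms(1) s(3,4) by (simp_all add: step_P fst_lab)
  have aV: "a \<in> verts (ball s)" "b \<in> verts (ball s)" using s(2) by (auto simp: step_def)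
  \<comment> \<open>\<open>\<delta>\<close> may reach the copy from the other centre, so it is first
    exchanged for a dart anchored at the ball that contains the step.\<close>
  obtain \<alpha> where al: "reach v w s \<alpha> a" using ball_reach[OF s(1) aV(1) n(1)] by metis
  then have "copy_reached c \<alpha>" unfolding copy_reached_def using s aV by (auto simp: fst_lab)
  then have e: "eqv v w \<delta> \<alpha>" using copy_reached_eqv assms(2) by blast
  show ?thesis
  proof (cases "a = b")
    case True
    then show ?thesis using that assms(2) s eqv_refl by metis
  next
    case False
    have "sadj G a b" "shrt (d s a + d s b + 1)"
      using s(2) False by (auto simp: step_ball[OF centre_V[OF s(1)]] sadj_def)
    then obtain \<epsilon> where "eqv v w \<alpha> \<epsilon>" "reach v w s \<epsilon> b"
      using reach_step[OF v_in w_in s(1) al _ n(2)] by blast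
    moreover then have "copy_reached c' \<epsilon>" unfolding copy_reached_def using s aV by (auto simp: fst_lab)
    ultimately show ?thesis using that e eqv_trans by blast
  qed
qed

lemma joined_eqv:
  assumes "joined P c c'" "copy_reached c \<delta>" "copy_reached c' \<epsilon>"
  shows "eqv v w \<delta> \<epsilon>"
proof -
  have "(step P)\<^sup>*\<^sup>* c c'" using assms(1) by (simp add: joined_iff)
  then have "\<exists>\<phi>. copy_reached c' \<phi> \<and> eqv v w \<delta> \<phi>"
  proof (induction)
    case base
    then show ?case using assms(2) eqv_refl by blast
  next
    case (step y z)
    then show ?case using copy_reached_step eqv_trans by metis
  qed
  then show ?thesis using copy_reached_eqv assms(3) eqv_trans by blast
qed

text \<open>The bound is the length of the closed walk from \<open>s\<close> to \<open>y\<close>,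
  along \<open>xs\<close> to \<open>x\<close> and back. Each edge of \<open>xs\<close> closes up at
  \<open>s\<close> to no greater length, so it lies in the ball.\<close>

lemma walk_joined:
  assumes s: "s \<in> {v, w}"
  shows "vwalk y xs x \<Longrightarrow> set xs \<inter> {v, w} = {} \<Longrightarrow> y \<in> verts G \<Longrightarrow>
    shrt (length xs - 1 + d s y + d s x) \<Longrightarrow> joined P (lab s y) (lab s x)"
proof (induction xs arbitrary: y)
  case Nil
  then show ?case by (simp add: vwalk_def)
next
  case (Cons a xs)
  note sV = centre_V[OF s]
  show ?case
  proof (cases xs)
    case Nil
    then have "y = x" "y \<in> verts (ball s)" "y \<notin> {v, w}"
      using Cons.prems by (auto simp: vwalk_def verts_ball[OF sV] mult_2)
    moreover from this have "lab s y \<in> verts P" using s unfolding verts_P verts_H fst_lab by blast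
    ultimately show ?thesis using joined_refl by simp
  next
    case (Cons b ys)
    have a: "a = y" "sadj G y b" "vwalk b xs x" using Cons.prems(1) Cons by (auto simp: vwalk_def)
    have bV: "b \<in> verts G" using adj_V2 a(2) by blast
    have xs1: "1 \<le> length xs" using Cons by simp
    have db: "d s b \<le> d s y + 1" using d_step[OF sV] a(2) by (simp add: sadj_def)
    have xV: "x \<in> verts G" using vwalk_in_V[OF a(3) bV] a(3) by (metis in_mono last_in_set vwalk_def)
    have "d b x \<le> length xs - 1" using d_le[OF a(3)] xs1 by simp
    then have "d s b \<le> length xs - 1 + d s x"
      using d_triangle[OF sV xV bV] d_sym[OF bV xV] by simp
    then have "shrt (d s y + d s b + 1)" using Cons.prems(4) xs1 by (auto elim!: short_mono)
    then have "step (ball s) y b" using a(2) by (simp add: step_ball[OF sV] sadj_def)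
    then have "step P (lab s y) (lab s b)"
      using s Cons.prems(2) a(1) Cons unfolding step_P step_H fst_lab by auto
    moreover have "shrt (length xs - 1 + d s b + d s x)"
      using Cons.prems(4) db xs1 by (auto elim!: short_mono)
    then have "joined P (lab s b) (lab s x)"
      using Cons.IH[OF a(3) _ bV] Cons.prems(2) by simp
    ultimately show ?thesis using joined_step joined_trans by metis
  qed
qed

definition dart_copy :: "'v \<times> 'v \<Rightarrow> ('v, 'e) copy" where
  "dart_copy \<delta> = lab (fst \<delta>) (snd \<delta>)"

lemma short2: "shrt 2"
  using short_mono[OF close] d_pos[OF v_in w_in v_neq_w] by simp

lemma dart_ball:
  assumes "dart v w (s, y)"
  shows "s \<in> {v, w}" "y \<in> verts (ball s)" "y \<notin> {v, w}" "sadj G s y"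
proof -
  show a: "s \<in> {v, w}" "y \<notin> {v, w}" "sadj G s y" using assms by (auto simp: dart_def)
  show "y \<in> verts (ball s)"
    using adj_V2[OF a(3)] d_adj[OF a(3)] short2 by (auto simp: verts_ball[OF centre_V[OF a(1)]] elim!: short_mono)
qed

lemma copy_reached_dart_copy: "dart v w \<delta> \<Longrightarrow> copy_reached (dart_copy \<delta>) \<delta>"
proof -
  assume "dart v w \<delta>"
  then obtain s y where \<delta>: "\<delta> = (s, y)" and sy: "dart v w (s, y)" by (cases \<delta>) auto
  note D = dart_ball[OF sy]
  have "length [y] + d s s + d s y \<le> 2" using d_adj[OF D(4)] by simp
  then have "reach v w s (s, y) y"
    using reachI[OF vwalk_self _ D(4,1)] D(3) short_mono[OF short2] by auto
  then show ?thesis unfolding copy_reached_def dart_copy_def \<delta> using D by (auto simp: fst_lab)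
qed

lemma dart_copy_verts: "dart v w \<delta> \<Longrightarrow> dart_copy \<delta> \<in> verts P"
  using dart_ball[of "fst \<delta>" "snd \<delta>"] by (auto simp: verts_P verts_H dart_copy_def fst_lab)

text \<open>The walk lifts to the ball around the first centre. Its last vertex then carries the
  label from that ball, and \<open>label_eq\<close> identifies it with the copy in the ball around
  the other centre.\<close>

lemma link_joined:
  assumes l: "link v w \<delta> \<epsilon>"
  shows "joined P (dart_copy \<delta>) (dart_copy \<epsilon>)"
proof -
  obtain s y t z where de: "\<delta> = (s, y)" "\<epsilon> = (t, z)" by fastforce
  obtain xs where xs: "vwalk y xs z" "set xs \<inter> {v, w} = {}" "shrt (length xs + 1 + d s t)"
    "sadj G s y" "sadj G t z" "s \<in> {v, w}" "t \<in> {v, w}" using l de by (auto simp: link_def)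
  note sV = centre_V[OF xs(6)] and yV = adj_V2[OF xs(4)]
  have x1: "xs \<noteq> []" using xs(1) by (simp add: vwalk_def)
  have "d s y \<le> 1" using d_adj xs by blast
  moreover have "d s z \<le> d s t + 1" using d_step[OF sV] xs(5) by (simp add: sadj_def)
  ultimately have "shrt (length xs - 1 + d s y + d s z)" using xs(3) x1 by (cases xs) (auto elim!: short_mono)
  then have j: "joined P (lab s y) (lab s z)" using walk_joined[OF xs(6,1,2) yV] by blast
  have "lab s z = lab t z"
  proof (cases "s = t")
    case False
    have "d s z \<le> length xs" using d_le[OF vwalk_Cons[OF xs(4,1)]] by simp
    then have "shrt (d s t + d s z + 1)" using xs(3) by (auto elim!: short_mono)
    then show ?thesis using label_eq[OF xs(6,7) False _ xs(5)] xs(1,2)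
      by (metis disjoint_iff last_in_set vwalk_def)
  qed simp
  then show ?thesis using j by (simp add: dart_copy_def de)
qed

lemma eqv_joined:
  assumes "eqv v w \<delta> \<epsilon>" "dart v w \<delta>"
  shows "joined P (dart_copy \<delta>) (dart_copy \<epsilon>)"
  using assms(1) unfolding eqv_def
proof (induction)
  case base
  show ?case by (rule joined_refl[OF dart_copy_verts[OF assms(2)]])
next
  case (step y z)
  show ?case by (rule joined_trans[OF step.IH link_joined[OF step.hyps(2)]])
qed

text \<open>The canonical walk leads back from any copy to a neighbour of \<open>v\<close> or
  \<open>w\<close>. If that neighbour belongs to the other centre, \<open>label_eq\<close> again
  makes it a dart copy.\<close>

lemma joined_dart:
  assumes "c \<in> verts P"
  obtains \<delta> where "dart v w \<delta>" "joined P (dart_copy \<delta>) c"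
proof -
  obtain s x where sx: "s \<in> {v, w}" "x \<in> verts (ball s)" "c = lab s x"
    using assms unfolding verts_P verts_H by blast
  then have s: "s \<in> {v, w}" "x \<in> verts (ball s)" "c = lab s x" "x \<notin> {v, w}"
    using assms by (simp_all add: verts_P fst_lab)
  note sV = centre_V[OF s(1)]
  obtain t y ys where y: "t \<in> {v, w}" "sadj G t y" "vwalk y ys x" "set ys \<inter> {v, w} = {}"
    "length ys + d s t = d s x" using ball_reach[OF s(1,2,4)] by metis
  have sh: "shrt (2 * d s x)" using s(2) by (simp add: verts_ball[OF sV])
  have yn: "y \<notin> {v, w}" "ys \<noteq> []" using y(3,4) by (auto simp: vwalk_def)
  have dy: "d s y \<le> d s t + 1" using d_step[OF sV] y(2) by (simp add: sadj_def)
  have "length ys - 1 + d s y + d s x \<le> 2 * d s x" using dy y(5) yn(2) by (cases ys) auto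
  then have j: "joined P (lab s y) (lab s x)"
    using walk_joined[OF s(1) y(3,4) adj_V2[OF y(2)]] short_mono[OF sh] by blast
  have "lab s y = lab t y"
  proof (cases "s = t")
    case False
    have "d s t + d s y + 1 \<le> 2 * d s x" using dy y(5) yn(2) by (cases ys) auto
    then show ?thesis using label_eq[OF s(1) y(1) False yn(1) y(2)] short_mono[OF sh] by blast
  qed simp
  then have "joined P (dart_copy (t, y)) c" using j s(3) by (simp add: dart_copy_def)
  moreover have "dart v w (t, y)" using y yn by (simp add: dart_def)
  ultimately show ?thesis using that by blast
qed

text \<open>Classes of darts correspond to components: \<open>eqv_joined\<close> makes
  \<open>dart_copy\<close> well defined on classes, \<open>joined_dart\<close> makes it surjective
  and \<open>joined_eqv\<close> injective.\<close>

lemma disconnected_P_iff: "disconnected_graph P \<longleftrightarrow> sep v w"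
proof
  assume "disconnected_graph P"
  then obtain c c' where c: "c \<in> verts P" "c' \<in> verts P" "\<not> joined P c c'"
    by (auto simp: disconnected_graph_def)
  obtain \<delta> \<epsilon> where "dart v w \<delta>" "joined P (dart_copy \<delta>) c" "dart v w \<epsilon>" "joined P (dart_copy \<epsilon>) c'"
    by (rule joined_dart[OF c(1)], rule joined_dart[OF c(2)]) (rule that)
  note de = this
  have "\<not> eqv v w \<delta> \<epsilon>"
  proof
    assume "eqv v w \<delta> \<epsilon>"
    from joined_trans[OF joined_trans[OF joined_sym[OF de(2)] eqv_joined[OF this de(1)]] de(4)] show False
      using c(3) by contradiction
  qed
  with de(1,3) show "sep v w" unfolding sep_def using v_in w_in v_neq_w close by blast
next
  assume "sep v w"
  then obtain \<delta> \<epsilon> where "dart v w \<delta>" "dart v w \<epsilon>" "\<not> eqv v w \<delta> \<epsilon>" by (auto simp: sep_def)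
  note de = this
  have "\<not> joined P (dart_copy \<delta>) (dart_copy \<epsilon>)"
    using joined_eqv[OF _ copy_reached_dart_copy[OF de(1)] copy_reached_dart_copy[OF de(2)]] de(3) by blast
  then show "disconnected_graph P"
    unfolding disconnected_graph_def using dart_copy_verts[OF de(1)] dart_copy_verts[OF de(2)] by blast
qed

end

section \<open>Projecting cycles of the explorer-neighbourhood\<close>

lemma successively_split:
  "successively R (xs @ y # ys) \<longleftrightarrow> successively R (xs @ [y]) \<and> successively R (y # ys)"
  by (auto simp: successively_append_iff)

lemma successively_step_rev: "successively (step H) (rev xs) \<longleftrightarrow> successively (step H) xs"
proof -
  have "(\<lambda>x y. step H y x) = step H" by (intro ext iffI; rule step_sym)
  then show ?thesis unfolding successively_rev by (rule arg_cong[of _ _ "\<lambda>R. successively R xs"])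
qed

context short_graph begin

text \<open>Distinct copies on a cycle may lie over the same vertex, so a projected arc can visit
  \<open>a\<close> repeatedly. Cutting out everything between the first and the last visit keeps the
  first dart.\<close>

lemma vwalk_visit_once:
  assumes "vwalk v (v # S @ [w]) w" "a \<in> set S"
  obtains A1 A2 where "vwalk v (v # A1 @ a # A2 @ [w]) w" "a \<notin> set A1 \<union> set A2"
    "hd (A1 @ [a]) = hd S" "set (A1 @ a # A2) \<subseteq> set S" "length A1 + length A2 + 1 \<le> length S"
proof -
  obtain A1 R where 1: "S = A1 @ a # R" "a \<notin> set A1" using assms(2) by (meson split_list_first)
  obtain X A2 where 2: "a # R = X @ a # A2" "a \<notin> set A2" by (metis list.set_intros(1) split_list_last)
  have len: "length R = length X + length A2" using arg_cong[OF 2(1), of length] by simp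
  have "set A2 \<subseteq> set S" using arg_cong[OF 2(1), of set] 1(1) by auto
  have e: "v # S @ [w] = (v # A1) @ a # (R @ [w])" "v # S @ [w] = (v # A1 @ X) @ a # (A2 @ [w])"
    using 1(1) 2(1) by simp_all
  from vwalk_join[OF vwalk_split(1)[OF assms(1)[unfolded e(1)]] vwalk_split(2)[OF assms(1)[unfolded e(2)]]] have w: "vwalk v (v # A1 @ a # A2 @ [w]) w" by simp
  show ?thesis
  proof (rule that[OF w])
    show "hd (A1 @ [a]) = hd S" unfolding 1(1) hd_append_Cons[of A1 a R] ..
  qed (use 1 2(2) len \<open>set A2 \<subseteq> set S\<close> in auto)
qed

lemma crossing_from_arcs:
  assumes S: "vwalk v (v # S @ [w]) w" "a \<in> set S" and T: "vwalk v (v # T @ [w]) w" "b \<in> set T"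
    and vw: "v \<noteq> w" "{v, w} \<inter> (set S \<union> set T) = {}" and sh: "short (length S + length T + 2)"
    and ne: "\<not> eqv v w (v, hd S) (v, hd T)"
  shows "\<exists>A1 A2 B1 B2. crossing v w a b A1 A2 B1 B2"
proof -
  obtain A1 A2 where A: "vwalk v (v # A1 @ a # A2 @ [w]) w" "a \<notin> set A1 \<union> set A2"
    "hd (A1 @ [a]) = hd S" "set (A1 @ a # A2) \<subseteq> set S" "length A1 + length A2 + 1 \<le> length S"
    using vwalk_visit_once[OF S] by blast
  obtain B1 B2 where B: "vwalk v (v # B1 @ b # B2 @ [w]) w" "b \<notin> set B1 \<union> set B2"
    "hd (B1 @ [b]) = hd T" "set (B1 @ b # B2) \<subseteq> set T" "length B1 + length B2 + 1 \<le> length T"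
    using vwalk_visit_once[OF T] by blast
  have "length A1 + length A2 + length B1 + length B2 + 4 \<le> length S + length T + 2"
    using A(5) B(5) by simp
  note sh' = short_mono[OF sh this]
  have n: "v \<notin> set S \<union> set T" "w \<notin> set S \<union> set T" using vw(2) by auto
  have "crossing v w a b A1 A2 B1 B2"
    unfolding crossing_def A(3) B(3)
  proof (intro conjI)
    show "v \<notin> set (A1 @ a # A2 @ B1 @ b # B2)" "w \<notin> set (A1 @ a # A2 @ B1 @ b # B2)"
      using n A(4) B(4) by auto
  qed (use A(1,2) B(1,2) vw(1) ne sh' in simp_all)
  then show ?thesis by (intro exI)
qed

end

context close_pair begin

lemma verts_P_sub: "L \<subseteq> verts H \<Longrightarrow> \<not> (\<exists>c \<in> L. fst c \<in> {v, w}) \<Longrightarrow> L \<subseteq> verts P"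
  unfolding subset_iff verts_P by blast

lemma list_joined:
  "successively (step H) L \<Longrightarrow> set L \<subseteq> verts P \<Longrightarrow> x \<in> set L \<Longrightarrow> joined P (hd L) x"
proof (induction L)
  case (Cons c L)
  show ?case
  proof (cases "x = c")
    case True
    then show ?thesis using Cons.prems(2) by (auto intro: joined_refl)
  next
    case False
    then have x: "x \<in> set L" "L \<noteq> []" using Cons.prems(3) by auto
    have "joined P (hd L) x" "step H c (hd L)"
      using Cons x by (auto simp: successively_Cons)
    moreover have "c \<in> verts P" "hd L \<in> verts P" using Cons.prems(2) x(2) by auto
    ultimately have "step P c (hd L)" unfolding step_P verts_P by blast
    from joined_trans[OF joined_step[OF this] \<open>joined P (hd L) x\<close>] show ?thesis by simp
  qed
qed simp

lemma centre_verts: "s \<in> {v, w} \<Longrightarrow> x \<in> {v, w} \<Longrightarrow> x \<in> verts (ball s)"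
  using close d_sym[OF v_in w_in] v_in w_in by (auto simp: verts_ball elim!: short_mono)

text \<open>Both centres lie in the core and in both balls, so their labels are trivial paths. Hence
  a cycle meets at most two copies of centres.\<close>

lemma centre_unique:
  assumes "c \<in> verts H" "fst c \<in> {v, w}" "c' \<in> verts H" "fst c' = fst c"
  shows "c = c'"
proof -
  have "snd c = {([fst c], [])}" if c: "c \<in> verts H" "fst c \<in> {v, w}" for c
  proof -
    obtain s a where s: "s \<in> {v, w}" "c = lab s a" using c(1) by (auto simp: verts_H)
    then have a: "a = fst c" by (simp add: fst_lab)
    have "a \<in> C" "a \<in> verts (ball s)" using centre_verts[OF s(1)] c(2) core_v core_w a by auto
    then have "shortest_paths (ball s) C a = {([a], [])}" by (rule shortest_paths_trivial)
    moreover have "snd c = shortest_paths (ball s) C a" using s(2) by (simp add: lab_def labelled_def)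
    ultimately show ?thesis unfolding a by simp
  qed
  from this[OF assms(1,2)] this[OF assms(3)] show ?thesis using assms(2,4) by (simp add: prod_eq_iff)
qed

text \<open>An edge at \<open>v\<close> may come from the ball around \<open>w\<close>; by
  \<open>label_eq\<close> its other end is nevertheless the copy in the ball around
  \<open>v\<close>.\<close>

lemma centre_step:
  assumes "step H k c" "fst k = v" "fst c \<notin> {v, w}"
  shows "c = lab v (fst c)" "dart v w (v, fst c)"
proof -
  obtain s a b where s: "s \<in> {v, w}" "step (ball s) a b" "k = lab s a" "c = lab s b"
    using assms(1) unfolding step_H by blast
  have ab: "a = v" "b = fst c" using s(3,4) assms(2) by (auto simp: fst_lab)
  have st: "step G v b" "shrt (d s v + d s b + 1)" using s(2) ab step_ball[OF centre_V[OF s(1)]] by auto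
  have nb: "b \<notin> {v, w}" using assms(3) unfolding ab(2) .
  then have adj: "sadj G v b" using st(1) by (auto simp: sadj_def)
  show "dart v w (v, fst c)" unfolding ab(2)[symmetric] using adj nb by (simp add: dart_def)
  show "c = lab v (fst c)"
  proof (cases "s = v")
    case True
    then show ?thesis using s(4) unfolding ab(2)[symmetric] by simp
  next
    case False
    have "lab s b = lab v b" by (rule label_eq[OF s(1) _ False nb adj st(2)]) simp
    then show ?thesis using s(4) unfolding ab(2)[symmetric] by simp
  qed
qed

text \<open>Adjacent copies come from one ball, in which each vertex has a single copy. So distinct
  adjacent copies lie over distinct vertices, and no step projects to a loop.\<close>

lemma arc_project:
  assumes "successively (step H) (k # S @ [l])" "distinct (k # l # S)" "fst k = x" "fst l = y"
  shows "vwalk x (x # map fst S @ [y]) y"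
proof -
  have proj: "sadj G (fst c) (fst c')" if c: "step H c c'" "c \<noteq> c'" for c c'
  proof -
    obtain s a b where s: "s \<in> {v, w}" "step (ball s) a b" "c = lab s a" "c' = lab s b"
      using c(1) unfolding step_H by blast
    then have "step G a b" "a \<noteq> b" using step_ball[OF centre_V[OF s(1)]] c(2) by auto
    then show ?thesis using s by (simp add: sadj_def fst_lab)
  qed
  have d: "distinct (k # S @ [l])" using assms(2) by auto
  have "successively (\<lambda>c c'. sadj G (fst c) (fst c')) (k # S @ [l])"
    unfolding successively_conv_nth
  proof (intro allI impI)
    fix i assume i: "Suc i < length (k # S @ [l])"
    have "(k # S @ [l]) ! i \<noteq> (k # S @ [l]) ! Suc i"
      using nth_eq_iff_index_eq[OF d, of i "Suc i"] i by simp
    then show "sadj G (fst ((k # S @ [l]) ! i)) (fst ((k # S @ [l]) ! Suc i))"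
      using proj successively_nth[OF assms(1) i] by blast
  qed
  then have "successively (sadj G) (map fst (k # S @ [l]))" by (simp only: successively_map)
  then show ?thesis using assms(3,4) by (simp add: vwalk_def)
qed

text \<open>If the first darts were equivalent, their copies would be joined, and the arcs, which
  avoid the centres, would join \<open>a\<close> to \<open>b\<close>.\<close>

lemma arcs_crossing:
  assumes S: "successively (step H) (k # S @ [l])" "a \<in> set S" "set S \<subseteq> verts P"
    and T: "successively (step H) (k # T @ [l])" "b \<in> set T" "set T \<subseteq> verts P"
    and dist: "distinct (k # l # S @ T)" and kl: "fst k = v" "fst l = w"
    and sh: "shrt (length S + length T + 2)" and nj: "\<not> joined P a b"
  shows "\<exists>A1 A2 B1 B2. crossing v w (fst a) (fst b) A1 A2 B1 B2"
proof -
  have ne: "S \<noteq> []" "T \<noteq> []" using S(2) T(2) by auto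
  have wS: "vwalk v (v # map fst S @ [w]) w" using arc_project[OF S(1) _ kl] dist by simp
  have wT: "vwalk v (v # map fst T @ [w]) w" using arc_project[OF T(1) _ kl] dist by simp
  have hS: "step H k (hd S)" "successively (step H) S"
    using S(1) ne by (auto simp: successively_Cons successively_append_iff)
  have hT: "step H k (hd T)" "successively (step H) T"
    using T(1) ne by (auto simp: successively_Cons successively_append_iff)
  have n: "fst c \<notin> {v, w}" if "c \<in> set S \<union> set T" for c
  proof -
    have "c \<in> verts P" using that S(3) T(3) by blast
    then show ?thesis unfolding verts_P by (rule conjunct2)
  qed
  have nS: "fst (hd S) \<notin> {v, w}" and nT: "fst (hd T) \<notin> {v, w}"
    by (rule n, simp add: ne)+
  note cS = centre_step[OF hS(1) kl(1) nS] and cT = centre_step[OF hT(1) kl(1) nT]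
  have e: "\<not> eqv v w (v, hd (map fst S)) (v, hd (map fst T))"
  proof
    assume "eqv v w (v, hd (map fst S)) (v, hd (map fst T))"
    then have "eqv v w (v, fst (hd S)) (v, fst (hd T))" using ne by (simp add: hd_map)
    from eqv_joined[OF this cS(2)] have "joined P (hd S) (hd T)"
      unfolding dart_copy_def fst_conv snd_conv cS(1)[symmetric] cT(1)[symmetric] .
    from joined_trans[OF joined_trans[OF joined_sym[OF list_joined[OF hS(2) S(3,2)]] this]
        list_joined[OF hT(2) T(3,2)]]
    show False using nj by contradiction
  qed
  have dis: "{v, w} \<inter> (set (map fst S) \<union> set (map fst T)) = {}"
    using n unfolding set_map by blast
  have ab: "fst a \<in> set (map fst S)" "fst b \<in> set (map fst T)" using S(2) T(2) by auto
  have sh': "shrt (length (map fst S) + length (map fst T) + 2)" using sh by simp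
  show ?thesis by (rule crossing_from_arcs[OF wS ab(1) wT ab(2) v_neq_w dis sh' e])
qed

text \<open>Both arcs of the cycle between \<open>a\<close> and \<open>b\<close> contain a copy of a
  centre, as otherwise \<open>a\<close> and \<open>b\<close> would be joined. Each centre has only
  one copy, so one arc contains \<open>v\<close> and the other \<open>w\<close>.\<close>

lemma cycle_crossing:
  assumes cyc: "is_cycle H xs es" and sh: "shrt (length es)"
    and ab: "a \<in> set xs" "b \<in> set xs" "a \<in> verts P" "b \<in> verts P" and nj: "\<not> joined P a b"
  shows "\<exists>A1 A2 B1 B2. crossing v w (fst a) (fst b) A1 A2 B1 B2"
proof -
  have len: "length xs = length es" and xs0: "xs \<noteq> []" and dist: "distinct xs" and xsH: "set xs \<subseteq> verts H"
    using cyc by (auto simp: is_cycle_def)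
  have "successively (step H) (xs @ [hd xs])"
    unfolding successively_conv_nth
  proof (intro allI impI)
    fix i assume i: "Suc i < length (xs @ [hd xs])"
    have 1: "(xs @ [hd xs]) ! i = xs ! i" using i by (simp add: nth_append)
    have 2: "(xs @ [hd xs]) ! Suc i = xs ! (Suc i mod length xs)"
    proof (cases "Suc i = length xs")
      case True
      then show ?thesis using xs0 by (simp add: nth_append hd_conv_nth)
    next
      case False
      then show ?thesis using i by (simp add: nth_append)
    qed
    have "es ! i \<in> edges H" "ends H (es ! i) = {xs ! i, xs ! (Suc i mod length xs)}"
      using cyc i len by (auto simp: is_cycle_def)
    moreover have "xs ! i \<in> verts H" "xs ! (Suc i mod length xs) \<in> verts H"
      using xsH i xs0 by (auto intro!: subsetD[OF xsH] nth_mem)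
    ultimately show "step H ((xs @ [hd xs]) ! i) ((xs @ [hd xs]) ! Suc i)"
      unfolding 1 2 step_def by blast
  qed
  moreover obtain X Y where XY: "xs = X @ a # Y" using ab(1) by (meson split_list)
  ultimately have suc: "successively (step H) (a # (Y @ X) @ [a])"
  proof (cases X)
    case Nil
    then show ?thesis using \<open>successively (step H) (xs @ [hd xs])\<close> XY by simp
  next
    case (Cons x X')
    then have "successively (step H) (X @ a # (Y @ [x]))"
      using \<open>successively (step H) (xs @ [hd xs])\<close> XY by simp
    then have "successively (step H) (x # X' @ [a])" "successively (step H) ((a # Y) @ [x])"
      using successively_split[of "step H" X a "Y @ [x]"] Cons by simp_all
    then have "successively (step H) ((a # Y) @ x # (X' @ [a]))"
      using successively_split[of "step H" "a # Y" x "X' @ [a]"] by blast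
    then show ?thesis using Cons by simp
  qed
  have "a \<noteq> b"
  proof
    assume "a = b"
    then show False using nj joined_refl[OF ab(3)] by simp
  qed
  then have "b \<in> set (Y @ X)" using ab(2) XY by auto
  then obtain R1 R2 where R: "Y @ X = R1 @ b # R2" by (meson split_list)
  have dR: "distinct (a # b # R1 @ R2)" and sR: "set (R1 @ R2) \<subseteq> verts H"
    and lR: "length R1 + length R2 + 2 = length es"
    using dist xsH len arg_cong[OF R, of distinct] arg_cong[OF R, of set] arg_cong[OF R, of length]
    unfolding XY by auto
  have s1: "successively (step H) (a # R1 @ [b])" and s2: "successively (step H) (b # R2 @ [a])"
    using suc successively_split[of "step H" "a # R1" b "R2 @ [a]"] unfolding R by auto
  have k1: "\<exists>k \<in> set R1. fst k \<in> {v, w}"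
  proof (rule ccontr)
    assume "\<not> ?thesis"
    then have "set R1 \<subseteq> verts P" using verts_P_sub sR by simp
    then have "set (a # R1 @ [b]) \<subseteq> verts P" using ab(3,4) by simp
    from list_joined[OF s1 this, of b] show False using nj by simp
  qed
  have k2: "\<exists>k \<in> set R2. fst k \<in> {v, w}"
  proof (rule ccontr)
    assume "\<not> ?thesis"
    then have "set R2 \<subseteq> verts P" using verts_P_sub sR by simp
    then have "set (b # R2 @ [a]) \<subseteq> verts P" using ab(3,4) by simp
    from joined_sym[OF list_joined[OF s2 this, of a]] show False using nj by simp
  qed
  from k1 obtain k P1 P2 where P: "R1 = P1 @ k # P2" "fst k \<in> {v, w}" by (meson split_list)
  from k2 obtain l Q1 Q2 where Q: "R2 = Q1 @ l # Q2" "fst l \<in> {v, w}" by (meson split_list)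
  have kl: "k \<in> verts H" "l \<in> verts H" "k \<noteq> l" using sR dR P Q by auto
  then have fkl: "fst k \<noteq> fst l" using centre_unique[of k l] P(2) by metis
  have inP: "c \<in> verts P" if c: "c \<in> verts H" "c \<noteq> k" "c \<noteq> l" for c
  proof -
    have "fst c \<noteq> fst k" using centre_unique[OF kl(1) P(2) c(1)] c(2) by blast
    moreover have "fst c \<noteq> fst l" using centre_unique[OF kl(2) Q(2) c(1)] c(3) by blast
    ultimately have "fst c \<notin> {v, w}" using fkl P(2) Q(2) by auto
    then show ?thesis using c(1) unfolding verts_P by blast
  qed
  have sP: "set (P1 @ P2 @ Q1 @ Q2) \<subseteq> verts P"
  proof
    fix c assume c: "c \<in> set (P1 @ P2 @ Q1 @ Q2)"
    have "c \<in> verts H" using c sR unfolding P(1) Q(1) by auto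
    moreover have "c \<noteq> k" "c \<noteq> l" using c dR unfolding P(1) Q(1) by auto
    ultimately show "c \<in> verts P" by (rule inP)
  qed
  have "successively (step H) (a # P1 @ [k])" "successively (step H) (k # P2 @ [b])"
    "successively (step H) (b # Q1 @ [l])" "successively (step H) (l # Q2 @ [a])"
    using s1 s2 successively_split[of "step H" "a # P1" k "P2 @ [b]"]
      successively_split[of "step H" "b # Q1" l "Q2 @ [a]"] unfolding P(1) Q(1) by auto
  \<comment> \<open>The cycle is cut anew, at \<open>k\<close> and \<open>l\<close> instead of
    \<open>a\<close> and \<open>b\<close>.\<close>
  then have arcs: "successively (step H) (l # (Q2 @ a # P1) @ [k])"
      "successively (step H) (k # (P2 @ b # Q1) @ [l])"
    using successively_split[of "step H" "l # Q2" a "P1 @ [k]"]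
      successively_split[of "step H" "k # P2" b "Q1 @ [l]"] by auto
  show ?thesis
  proof (cases "fst k = w")
    case True
    then have l: "fst l = v" using fkl Q(2) by auto
    have "successively (step H) (l # (Q2 @ a # P1) @ [k])"
      "successively (step H) (l # rev (P2 @ b # Q1) @ [k])"
      using arcs successively_step_rev[of H "k # (P2 @ b # Q1) @ [l]"] by auto
    note A = this
    show ?thesis
      by (rule arcs_crossing[OF A(1) _ _ A(2) _ _ _ l True _ nj])
        (use sP ab(3,4) dR lR sh P(1) Q(1) in \<open>auto simp: algebra_simps\<close>)
  next
    case False
    then have k: "fst k = v" "fst l = w" using fkl P(2) Q(2) by auto
    have "successively (step H) (k # rev (Q2 @ a # P1) @ [l])"
      "successively (step H) (k # (P2 @ b # Q1) @ [l])"
      using arcs successively_step_rev[of H "l # (Q2 @ a # P1) @ [k]"] by auto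
    note A = this
    show ?thesis
      by (rule arcs_crossing[OF A(1) _ _ A(2) _ _ _ k _ nj])
        (use sP ab(3,4) dR lR sh P(1) Q(1) in \<open>auto simp: algebra_simps\<close>)
  qed
qed

end

section \<open>Local separators and crossing in terms of darts\<close>

context connected_mgraph begin

lemma close_pair_core:
  assumes "v \<in> verts G" "w \<in> verts G" "v \<noteq> w" "shrt (2 * d v w)"
  shows "close_pair G r v w (core G v w)"
proof
  show "c \<in> verts G \<and> d v c + d c w = d v w" if "c \<in> core G v w" for c
    using core_dist[OF assms(1,2) that] by simp
  show "v \<in> core G v w" "w \<in> core G v w" by (fact core_ends[OF assms(1,2)])+
qed (fact assms)+

lemma punctured_expl_eq:
  assumes "close_pair G r v w (core G v w)"
  shows "expl r G v w = close_pair.H G r v w (core G v w)"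
    "punctured_expl r G v w = close_pair.P G r v w (core G v w)"
  unfolding close_pair.H_def[OF assms] close_pair.P_def[OF assms] punctured_expl_def expl_def Let_def
  by (rule refl)+

lemma local_2_separator_iff: "local_2_separator r G v w \<longleftrightarrow> sep v w"
proof (cases "v \<in> verts G \<and> w \<in> verts G \<and> v \<noteq> w \<and> shrt (2 * d v w)")
  case True
  then have c: "close_pair G r v w (core G v w)" using close_pair_core by blast
  have "2 * gdist G v w = enat (2 * d v w)"
    using True gdist_eq_d by (simp add: numeral_eq_enat)
  then show ?thesis
    using True close_pair.disconnected_P_iff[OF c] unfolding local_2_separator_def punctured_expl_eq(2)[OF c]
    by simp
next
  case False
  moreover have "2 * gdist G v w = enat (2 * d v w)" if "v \<in> verts G" "w \<in> verts G"
    using that gdist_eq_d by (simp add: numeral_eq_enat)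
  ultimately show ?thesis by (auto simp: local_2_separator_def sep_def)
qed

lemma separator_crosses_crossing:
  assumes "separator_crosses r G a b v w"
  shows "sep a b \<and> (\<exists>A1 A2 B1 B2. crossing v w a b A1 A2 B1 B2)"
proof -
  have s: "sep a b" "sep v w" using assms by (auto simp: separator_crosses_def local_2_separator_iff)
  have c: "close_pair G r v w (core G v w)" using s(2) close_pair_core by (auto simp: sep_def)
  obtain a' b' where ab: "fst a' = a" "fst b' = b" and cc: "copies_cross r G a' b' v w"
    using assms unfolding separator_crosses_def pair_crosses_def by blast
  obtain xs es where "is_cycle (expl r G v w) xs es" "shrt (length es)" "a' \<in> set xs" "b' \<in> set xs"
    using cc unfolding copies_cross_def by blast
  moreover have "a' \<in> verts (punctured_expl r G v w)" "b' \<in> verts (punctured_expl r G v w)"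
    "\<not> joined (punctured_expl r G v w) a' b'"
    using cc unfolding copies_cross_def by blast+
  ultimately have "\<exists>A1 A2 B1 B2. crossing v w (fst a') (fst b') A1 A2 B1 B2"
    unfolding punctured_expl_eq[OF c] by (rule close_pair.cycle_crossing[OF c])
  then show ?thesis using s(1) ab by simp
qed

end

section \<open>Cycle graphs\<close>

lemma simple_cycle_graph:
  assumes "simple_graph G" "is_cycle_graph_up_to_multiplicity r G"
  shows "is_cycle_graph r G"
proof -
  obtain xs es where c: "is_cycle G xs es" "verts G = set xs" "enat (length es) \<le> r"
    and e: "\<forall>e \<in> edges G. card (ends G e) = 1 \<or> ends G e \<in> ends G ` set es"
    using assms(2) unfolding is_cycle_graph_up_to_multiplicity_def by blast
  have sub: "set es \<subseteq> edges G" using c(1) by (simp add: is_cycle_def)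
  have "edges G \<subseteq> set es"
  proof
    fix f assume f: "f \<in> edges G"
    then have "card (ends G f) = 2" using assms(1) by (simp add: simple_graph_def)
    then obtain g where g: "g \<in> set es" "ends G f = ends G g" using e f by force
    have "f = g" using assms(1) f g sub unfolding simple_graph_def by (meson inj_onD subsetD)
    then show "f \<in> set es" using g by simp
  qed
  then show ?thesis using c sub unfolding is_cycle_graph_def by blast
qed

lemma simple_cycle_length:
  assumes "simple_graph G" "is_cycle G xs es"
  shows "3 \<le> length es"
proof (rule ccontr)
  assume n: "\<not> 3 \<le> length es"
  have c: "es \<noteq> []" "length xs = length es" "distinct es" "set es \<subseteq> edges G"
    "\<forall>i < length es. ends G (es ! i) = {xs ! i, xs ! (Suc i mod length xs)}"
    using assms(2) by (auto simp: is_cycle_def)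
  have s: "\<forall>e \<in> edges G. card (ends G e) = 2" "inj_on (ends G) (edges G)"
    using assms(1) by (auto simp: simple_graph_def)
  have "length es \<noteq> 0" using c(1) by simp
  then have "length es = 1 \<or> length es = 2" using n by linarith
  then show False
  proof
    assume "length es = 1"
    then have "ends G (es ! 0) = {xs ! 0}" "es ! 0 \<in> edges G" using c by auto
    then show False using s(1) by force
  next
    assume l: "length es = 2"
    then have "ends G (es ! 0) = ends G (es ! 1)" "es ! 0 \<in> edges G" "es ! 1 \<in> edges G"
      using c by (auto simp: insert_commute)
    then have "es ! 0 = es ! 1" using s(2) by (meson inj_onD)
    then show False using c(3) l nth_eq_iff_index_eq[of es 0 1] by simp
  qed
qed

text \<open>A cycle in a simple graph has at least three vertices, so here it is a triangle through
  all vertices, and any two of these are consecutive on it.\<close>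

lemma simple_small_cycle_graph:
  assumes G: "mgraph G" "simple_graph G" "\<not> at_least_four_vertices G"
    and c: "is_cycle G xs es" "enat (length es) \<le> r"
  shows "is_cycle_graph r G"
proof -
  have cD: "length xs = length es" "distinct xs" "set xs \<subseteq> verts G"
    "\<forall>i < length es. ends G (es ! i) = {xs ! i, xs ! (Suc i mod length xs)}"
    using c(1) by (auto simp: is_cycle_def)
  have fin: "finite (verts G)" "card (verts G) \<le> 3" using G(3) by (auto simp: at_least_four_vertices_def)
  have "card (set xs) = length es" using cD distinct_card by metis
  then have l: "length es = 3" "verts G = set xs"
    using simple_cycle_length[OF G(2) c(1)] card_mono[OF fin(1) cD(3)] fin card_seteq[OF fin(1) cD(3)] by auto
  obtain p q s where es: "es = [p, q, s]" using l(1) by (auto simp: numeral_3_eq_3 length_Suc_conv)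
  obtain x y z where xs: "xs = [x, y, z]" using l(1) cD(1) by (auto simp: numeral_3_eq_3 length_Suc_conv)
  have e: "ends G p = {x, y}" "ends G q = {y, z}" "ends G s = {z, x}"
    using cD(4)[rule_format, of 0] cD(4)[rule_format, of 1] cD(4)[rule_format, of 2]
    unfolding es xs by simp_all
  have "card (ends G f) = 1 \<or> ends G f \<in> ends G ` set es" if f: "f \<in> edges G" for f
  proof -
    obtain a b where "a \<in> set xs" "b \<in> set xs" "ends G f = {a, b}"
      using G(1) f l(2) unfolding mgraph_def by metis
    then show ?thesis using e by (auto simp: es xs insert_commute)
  qed
  then have "is_cycle_graph_up_to_multiplicity r G"
    using c l(2) unfolding is_cycle_graph_up_to_multiplicity_def by blast
  then show ?thesis using simple_cycle_graph[OF G(2)] by blast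
qed

lemma cycle_graph_up_to_multiplicity_if_adjacency:
  assumes G: "mgraph G" and xs: "distinct xs" "3 \<le> length xs" "enat (length xs) \<le> r" "verts G = set xs"
    and a: "\<forall>i < length xs. sadj G (xs ! i) (xs ! (Suc i mod length xs))"
    and b: "\<forall>x y. sadj G x y \<longrightarrow> (\<exists>i < length xs. {x, y} = {xs ! i, xs ! (Suc i mod length xs)})"
  shows "is_cycle_graph_up_to_multiplicity r G"
proof -
  let ?n = "length xs"
  have "\<forall>i. \<exists>e. i < ?n \<longrightarrow> e \<in> edges G \<and> ends G e = {xs ! i, xs ! (Suc i mod ?n)}"
    using a by (auto simp: sadj_def step_def)
  then obtain f where f: "\<And>i. i < ?n \<Longrightarrow> f i \<in> edges G \<and> ends G (f i) = {xs ! i, xs ! (Suc i mod ?n)}"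
    by metis
  define es where "es = map f [0..<?n]"
  have es: "length es = ?n" "\<And>i. i < ?n \<Longrightarrow> es ! i = f i" by (auto simp: es_def)
  have "inj_on f {0..<?n}"
  proof (rule inj_onI)
    fix i j assume ij: "i \<in> {0..<?n}" "j \<in> {0..<?n}" "f i = f j"
    then have "{xs ! i, xs ! (Suc i mod ?n)} = {xs ! j, xs ! (Suc j mod ?n)}" using f by (metis atLeastLessThan_iff)
    then consider "xs ! i = xs ! j" | "xs ! i = xs ! (Suc j mod ?n)" "xs ! (Suc i mod ?n) = xs ! j"
      by (auto simp: doubleton_eq_iff)
    then show "i = j"
    proof cases
      case 1
      then show ?thesis using nth_eq_iff_index_eq[OF xs(1)] ij by auto
    next
      case 2
      \<comment> \<open>The same ends in opposite order: the indices would be cyclic successors of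
        each other, which is impossible for length at least three.\<close>
      have "0 < ?n" using xs(2) by linarith
      then have "Suc i mod ?n < ?n" "Suc j mod ?n < ?n" by (fact mod_less_divisor)+
      then have "i = Suc j mod ?n" "Suc i mod ?n = j" using 2 nth_eq_iff_index_eq[OF xs(1)] ij by auto
      then show ?thesis using ij xs(2) by (auto simp: mod_Suc split: if_splits)
    qed
  qed
  then have "distinct es" by (simp add: es_def distinct_map)
  moreover have "es \<noteq> []" using xs(2) es(1) by auto
  moreover have "set es \<subseteq> edges G" using f by (auto simp: es_def)
  ultimately have "is_cycle G xs es" unfolding is_cycle_def using xs es f by auto
  moreover have "card (ends G e) = 1 \<or> ends G e \<in> ends G ` set es" if e: "e \<in> edges G" for e
  proof -
    obtain x y where xy: "x \<in> verts G" "y \<in> verts G" "ends G e = {x, y}" using G e unfolding mgraph_def by metis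
    show ?thesis
    proof (cases "x = y")
      case False
      then have "sadj G x y" using xy e by (auto simp: sadj_def step_def)
      then obtain i where i: "i < ?n" "{x, y} = {xs ! i, xs ! (Suc i mod ?n)}" using b by blast
      then have "ends G e = ends G (es ! i)" using f es(2) xy(3) by simp
      moreover have "es ! i \<in> set es" using i(1) es(1) nth_mem by metis
      ultimately show ?thesis by blast
    qed (use xy in simp)
  qed
  ultimately show ?thesis
    unfolding is_cycle_graph_up_to_multiplicity_def using xs es(1) by metis
qed

text \<open>Darts see neither loops nor parallel edges, so a separator only yields a cycle up to
  multiplicity. In a simple graph this is a genuine cycle; the other alternative of the second
  assumption rules it out. That alternative also provides four vertices, so only simple graphs
  remain when there are fewer.\<close>

theorem theorem1p3:
  fixes G :: "('v, 'e) mgraph" and r :: enat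
  assumes "mgraph G"
    and "simple_graph G \<or>
           (at_least_four_vertices G \<and> \<not> is_cycle_graph_up_to_multiplicity r G)"
    and "connected_graph G"
    and "locally_2_connected r G"
    and "\<And>v w. local_2_separator r G v w \<Longrightarrow> \<exists>a b. separator_crosses r G a b v w"
  shows "locally_3_connected r G \<or> is_cycle_graph r G"
proof -
  interpret connected_mgraph G r using assms(1,3) by unfold_locales
  interpret all_crossed_graph "verts G" "sadj G" "\<lambda>n. enat n \<le> r"
  proof
    show "(\<lambda>a b. sadj G a b \<and> a \<noteq> v \<and> b \<noteq> v \<and> shrt (d v a + d v b + 1))\<^sup>*\<^sup>* x y"
      if "v \<in> verts G" "x \<in> verts G" "y \<in> verts G" "x \<noteq> v" "y \<noteq> v" "shrt (2 * d v x)" "shrt (2 * d v y)"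
      for v x y
      using ball_connected_if_locally_2_connected[OF assms(4) that] .
    show "\<exists>a b A1 A2 B1 B2. sep a b \<and> crossing v w a b A1 A2 B1 B2" if "sep v w" for v w
      using assms(5) separator_crosses_crossing that unfolding local_2_separator_iff by blast
  qed
  show ?thesis
  proof (cases "\<exists>v w. local_2_separator r G v w")
    case True
    then obtain v w where "sep v w" by (auto simp: local_2_separator_iff)
    from cycle_if_sep[OF this] have "is_cycle_graph_up_to_multiplicity r G"
      using cycle_graph_up_to_multiplicity_if_adjacency[OF assms(1)] by blast
    then show ?thesis using assms(2) simple_cycle_graph by blast
  next
    case no_sep: False
    show ?thesis
    proof (cases "at_least_four_vertices G")
      case True
      then show ?thesis using no_sep assms(4) by (simp add: locally_3_connected_def)
    next
      case False
      then show ?thesis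
        using assms(1,2,4) simple_small_cycle_graph unfolding locally_2_connected_def by blast
    qed
  qed
qed

end
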